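(* Let $p\in(0,1)$. For each integer $n\ge 1$ let $\eta^{(n)}$ be the final stable configuration obtained by stabilizing $n$ particles placed at the origin of $\mathbb{Z}$ with $p$-topplings, and let $\mathtt{l}_n$ and $\mathtt{r}_n$ be its left and right boundary vertices. Then, as $n\to\infty$, $$\frac{\mathtt{l}_n+\frac{n}{2}}{\sqrt{n}}\xrightarrow{\mathcal{D}}\mathcal{N}\Big(0,\frac{1-p}{12}\Big)\qquad\text{and}\qquad\frac{\mathtt{r}_n-\frac{n}{2}}{\sqrt{n}}\xrightarrow{\mathcal{D}}\mathcal{N}\Big(0,\frac{1-p}{12}\Big),$$ where $\xrightarrow{\mathcal{D}}$ denotes convergence in distribution and $\mathcal{N}(0,\sigma^2)$ is the centered Gaussian distribution with variance $\sigma^2$.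
   Context: $\mathbb{N}=\{0,1,2,\dots\}$. A sandpile configuration is a function $\eta:\mathbb{Z}\to\mathbb{N}$; $\eta(v)$ is the number of particles at $v$. A vertex $v$ is stable if $\eta(v)\le 1$ and unstable otherwise; $\eta$ is stable if all vertices are stable. For $x\in\mathbb{Z}$, $\delta_x$ denotes the function equal to $1$ at $x$ and $0$ elsewhere. Fix $p\in(0,1)$. Let $(\xi_{x,i})_{x\in\mathbb{Z},i\in\mathbb{N}}$ be independent random toppling instructions with values in $\{\leftarrow,\rightarrow,\leftrightarrow,\varnothing\}$ and $\mathbb{P}(\xi_{x,i}=\leftarrow)=\mathbb{P}(\xi_{x,i}=\rightarrow)=p(1-p)$, $\mathbb{P}(\xi_{x,i}=\leftrightarrow)=p^2$, $\mathbb{P}(\xi_{x,i}=\varnothing)=(1-p)^2$. Applying an instruction at $x$ changes $\eta$ into: $\eta-\delta_x+\delta_{x-1}$ for $\leftarrow$; $\eta-\delta_x+\delta_{x+1}$ for $\rightarrow$; $\eta-2\delta_x+\delta_{x-1}+\delta_{x+1}$ for $\leftrightarrow$; $\eta$ for $\varnothing$. Stabilization of $n$ particles at the origin: set $\eta^{(n)}_0:=n\delta_0$ and $u_0:=0$ (the zero function on $\mathbb{Z}$). At time $k\in\mathbb{N}$, if $\eta^{(n)}_k$ is unstable, let $x_k$ be its leftmost unstable vertex, let $\eta^{(n)}_{k+1}$ be the result of applying the instruction $\xi_{x_k,u_k(x_k)}$ at $x_k$ to $\eta^{(n)}_k$, and set $u_{k+1}:=u_k+\delta_{x_k}$. If $\eta^{(n)}_k$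 is stable, set $\eta^{(n)}_{k+1}:=\eta^{(n)}_k$ and $u_{k+1}:=u_k$. Let $K_n:=\inf\{k\in\mathbb{N}\mid \eta^{(n)}_k\text{ is stable}\}$, which is almost surely finite; the final stable configuration is $\eta^{(n)}:=\eta^{(n)}_{K_n}$ (defined almost surely). Boundary vertices: $\mathtt{l}_n:=\inf\{v\in\mathbb{Z}\mid\eta^{(n)}(v)>0\}$ and $\mathtt{r}_n:=\sup\{v\in\mathbb{Z}\mid\eta^{(n)}(v)>0\}$. *)

theory Defs
  imports "HOL-Probability.Probability"
begin

datatype instr = ToLeft | ToRight | ToBoth | Nothing

type_synonym config = "int \<Rightarrow> nat"

definition delta :: "int \<Rightarrow> int \<Rightarrow> nat" where
  "delta x v = (if v = x then 1 else 0)"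

definition stable_at :: "config \<Rightarrow> int \<Rightarrow> bool" where
  "stable_at \<eta> v \<longleftrightarrow> \<eta> v \<le> 1"

definition stable :: "config \<Rightarrow> bool" where
  "stable \<eta> \<longleftrightarrow> (\<forall>v. stable_at \<eta> v)"

text \<open>The law of a single instruction: each of the two particles at the top of the
  pile independently decides to move with probability \<open>p\<close>.\<close>

fun instr_prob :: "real \<Rightarrow> instr \<Rightarrow> real" where
  "instr_prob p ToLeft = p * (1 - p)"
| "instr_prob p ToRight = p * (1 - p)"
| "instr_prob p ToBoth = p\<^sup>2"
| "instr_prob p Nothing = (1 - p)\<^sup>2"

text \<open>Instructions are only applied at unstable vertices \<open>x\<close>, where \<open>\<eta> x \<ge> 2\<close>, so the
  subtraction on \<open>nat\<close> never truncates.\<close>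

fun apply_instr :: "instr \<Rightarrow> int \<Rightarrow> config \<Rightarrow> config" where
  "apply_instr ToLeft x \<eta> = (\<lambda>v. \<eta> v - delta x v + delta (x - 1) v)"
| "apply_instr ToRight x \<eta> = (\<lambda>v. \<eta> v - delta x v + delta (x + 1) v)"
| "apply_instr ToBoth x \<eta> = (\<lambda>v. \<eta> v - 2 * delta x v + delta (x - 1) v + delta (x + 1) v)"
| "apply_instr Nothing x \<eta> = \<eta>"

text \<open>An unstable configuration reached from finitely many particles has finitely many,
  and at least one, unstable vertices, so the minimum exists.\<close>

definition leftmost_unstable :: "config \<Rightarrow> int" where
  "leftmost_unstable \<eta> = (LEAST v. \<not> stable_at \<eta> v)"

text \<open>The dynamics for a fixed realization \<open>\<xi>\<close> of the instructions; the state is the pair of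
  the current configuration and the odometer \<open>u\<close> (the number of instructions already used
  at each vertex).\<close>

definition topple_step ::
    "(int \<Rightarrow> nat \<Rightarrow> instr) \<Rightarrow> config \<times> (int \<Rightarrow> nat) \<Rightarrow> config \<times> (int \<Rightarrow> nat)" where
  "topple_step \<xi> = (\<lambda>(\<eta>, u).
     if stable \<eta> then (\<eta>, u)
     else let x = leftmost_unstable \<eta>
          in (apply_instr (\<xi> x (u x)) x \<eta>, \<lambda>v. u v + delta x v))"

primrec sandpile_state ::
    "(int \<Rightarrow> nat \<Rightarrow> instr) \<Rightarrow> nat \<Rightarrow> nat \<Rightarrow> config \<times> (int \<Rightarrow> nat)" where
  "sandpile_state \<xi> n 0 = (\<lambda>v. n * delta 0 v, \<lambda>v. 0)"
| "sandpile_state \<xi> n (Suc k) = topple_step \<xi> (sandpile_state \<xi> n k)"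

definition sandpile_config :: "(int \<Rightarrow> nat \<Rightarrow> instr) \<Rightarrow> nat \<Rightarrow> nat \<Rightarrow> config" where
  "sandpile_config \<xi> n k = fst (sandpile_state \<xi> n k)"

text \<open>Stabilization happens only almost surely. If it fails, the set below is empty and its
  infimum is a fixed but irrelevant natural number, the same for all realizations, so that
  the final configuration remains measurable as a function of the instructions.\<close>

definition stab_time :: "(int \<Rightarrow> nat \<Rightarrow> instr) \<Rightarrow> nat \<Rightarrow> nat" where
  "stab_time \<xi> n = Inf {k. stable (sandpile_config \<xi> n k)}"

definition final_config :: "(int \<Rightarrow> nat \<Rightarrow> instr) \<Rightarrow> nat \<Rightarrow> config" where
  "final_config \<xi> n = sandpile_config \<xi> n (stab_time \<xi> n)"

text \<open>For \<open>n \<ge> 1\<close> the final configuration has finite nonempty support, so the following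
  infimum and supremum in \<open>int\<close> are attained.\<close>

definition left_boundary :: "config \<Rightarrow> int" where
  "left_boundary \<eta> = Inf {v. \<eta> v > 0}"

definition right_boundary :: "config \<Rightarrow> int" where
  "right_boundary \<eta> = Sup {v. \<eta> v > 0}"

definition centered_normal :: "real \<Rightarrow> real measure" where
  "centered_normal var = density lborel (\<lambda>x. ennreal (normal_density 0 (sqrt var) x))"

end

theory Submission
  imports Defs "HOL-Real_Asymp.Real_Asymp"
begin

text \<open>
  The total displacement \<open>\<Sum>v. v * \<eta> v\<close> of the particles is a simple random walk with lazy steps, run with
  the instructions in the order in which they are used; these form an i.i.d. sequence because no
  instruction is used twice. A stable final configuration is an interval with at most one hole, so
  both of its end points are determined up to \<open>O(1)\<close> by the displacement divided by \<open>n\<close>. The second moment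
  \<open>\<Sum>v. v\<^sup>2 * \<eta> v\<close> grows by \<open>2 * p\<close> per step on average and ends near \<open>n\<^sup>3 / 12\<close>, so the number of
  steps concentrates around \<open>n\<^sup>3 / (24 * p)\<close>. Since a step has variance \<open>2 * p * (1 - p)\<close>, the displacement
  is asymptotically normal with variance \<open>(1 - p) * n\<^sup>3 / 12\<close>.
\<close>

subsection \<open>Shape of the configurations\<close>

text \<open>Two obstacles shape the argument. First, an off-centre interval has an extra second
  moment of about \<open>n\<close> times its squared centre, which in the worst case is itself of
  order \<open>n ^ 3\<close>. It is expressed through the squared displacement divided by
  \<open>n\<close>. The displacement is a martingale whose variance is proportional to the mean
  number of steps, which the trivial bound \<open>n ^ 3\<close> on the second moment controls, so on
  average the extra term is only of order \<open>n ^ 2\<close>. Second, the number of steps is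
  random and depends on the walk. It deviates from its centre by order \<open>n powr (5/2)\<close>
  in mean, so exchanging it for a deterministic time changes the displacement by order
  \<open>n powr (5/4)\<close>, below its scale \<open>n powr (3/2)\<close>. Termination needs no
  separate argument: with time horizon at least \<open>n ^ 4\<close>, Markov's inequality leaves
  probability of order \<open>1 / n\<close> for being still unstable, and characteristic functions
  absorb that event.\<close>

definition left_moves :: "instr \<Rightarrow> int" where
  "left_moves a = of_bool (a = ToLeft \<or> a = ToBoth)"

definition right_moves :: "instr \<Rightarrow> int" where
  "right_moves a = of_bool (a = ToRight \<or> a = ToBoth)"

lemma moves_cases:
  "left_moves a = 0 \<or> left_moves a = 1" "right_moves a = 0 \<or> right_moves a = 1"
  by (auto simp: left_moves_def right_moves_def)

text \<open>Counting \<open>ToBoth\<close> as one left and one right move covers all four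
  instructions by one linear formula; two particles at \<open>x\<close> keep the subtraction on
  \<open>nat\<close> from truncating.\<close>

lemma int_apply_instr:
  assumes "2 \<le> \<eta> x"
  shows "int (apply_instr a x \<eta> v) = int (\<eta> v) - (left_moves a + right_moves a) * of_bool (v = x)
           + left_moves a * of_bool (v = x - 1) + right_moves a * of_bool (v = x + 1)"
  using assms by (cases a) (auto simp: left_moves_def right_moves_def delta_def)

lemma sum_apply_instr:
  assumes "2 \<le> \<eta> x" "finite A"
  shows "(\<Sum>v\<in>A. f v * int (apply_instr a x \<eta> v)) = (\<Sum>v\<in>A. f v * int (\<eta> v))
    - (left_moves a + right_moves a) * (of_bool (x \<in> A) * f x)
    + left_moves a * (of_bool (x - 1 \<in> A) * f (x - 1))
    + right_moves a * (of_bool (x + 1 \<in> A) * f (x + 1))"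
proof -
  have pick: "(\<Sum>v\<in>A. f v * (c * of_bool (v = y))) = c * (of_bool (y \<in> A) * f y)" for c y :: int
  proof -
    have "(\<Sum>v\<in>A. f v * (c * of_bool (v = y))) = (\<Sum>v\<in>A. if y = v then c * f v else 0)"
      by (rule sum.cong) auto
    then show ?thesis using assms(2) by simp
  qed
  show ?thesis
    unfolding int_apply_instr[of \<eta> x a, OF assms(1)]
    by (simp add: distrib_left right_diff_distrib sum.distrib sum_subtractf pick)
qed

text \<open>The last conjunct says that any two empty sites between \<open>l\<close> and \<open>r\<close> have an unstable site
  between them.\<close>

definition spread :: "int \<Rightarrow> int \<Rightarrow> nat \<Rightarrow> config \<Rightarrow> bool" where
  "spread l r n \<eta> \<longleftrightarrow> l \<le> 0 \<and> 0 \<le> r \<and> (\<forall>v. v \<notin> {l..r} \<longrightarrow> \<eta> v = 0) \<and> 0 < \<eta> l \<and> 0 < \<eta> r \<and>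
     (\<Sum>v\<in>{l..r}. int (\<eta> v)) = int n \<and>
     (\<forall>a b. l \<le> a \<longrightarrow> a \<le> b \<longrightarrow> b \<le> r \<longrightarrow> b - a \<le> (\<Sum>v\<in>{a..b}. int (\<eta> v)))"

lemma spreadD:
  assumes "spread l r n \<eta>"
  shows "l \<le> 0" "0 \<le> r" "v < l \<or> r < v \<Longrightarrow> \<eta> v = 0" "0 < \<eta> l" "0 < \<eta> r"
    "(\<Sum>v\<in>{l..r}. int (\<eta> v)) = int n"
    "l \<le> a \<Longrightarrow> a \<le> b \<Longrightarrow> b \<le> r \<Longrightarrow> b - a \<le> (\<Sum>v\<in>{a..b}. int (\<eta> v))"
  using assms unfolding spread_def atLeastAtMost_iff by (blast, blast, force simp only: not_le, blast+)

lemma spread_init: "0 < n \<Longrightarrow> spread 0 0 n (\<lambda>v. n * delta 0 v)"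
proof -
  assume n: "0 < n"
  have "b - a \<le> (\<Sum>v\<in>{a..b}. int (n * delta 0 v))" if "0 \<le> a" "a \<le> b" "b \<le> 0" for a b
  proof -
    have "a = 0" "b = 0" using that by auto
    then show ?thesis by simp
  qed
  then show ?thesis using n by (auto simp: spread_def delta_def)
qed

lemma spread_leftmost_unstable:
  assumes "spread l r n \<eta>" "\<not> stable \<eta>"
  shows "2 \<le> \<eta> (leftmost_unstable \<eta>)"
proof -
  have "\<not> stable_at \<eta> v \<Longrightarrow> v \<in> {l..r}" for v
    using assms(1) unfolding spread_def stable_at_def by (metis zero_le_one)
  then have "{v. \<not> stable_at \<eta> v} \<subseteq> {l..r}" by blast
  then have "finite {v. \<not> stable_at \<eta> v}" by (rule finite_subset) simp
  moreover have "{v. \<not> stable_at \<eta> v} \<noteq> {}"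
    using assms(2) by (auto simp: stable_def)
  ultimately have "leftmost_unstable \<eta> \<in> {v. \<not> stable_at \<eta> v}"
    unfolding leftmost_unstable_def by (subst Least_Min) (auto intro!: Min_in simp del: mem_Collect_eq)
  then show ?thesis by (simp add: stable_at_def)
qed

lemma sum_int_interval_split:
  fixes f :: "int \<Rightarrow> int"
  assumes "a \<le> b"
  shows "(\<Sum>v\<in>{a..b}. f v) = f a + (\<Sum>v\<in>{a+1..b}. f v)"
    "(\<Sum>v\<in>{a..b}. f v) = f b + (\<Sum>v\<in>{a..b-1}. f v)"
proof -
  have "{a..b} = insert a {a+1..b}" "{a..b} = insert b {a..b-1}" using assms by auto
  moreover have "a \<notin> {a+1..b}" "b \<notin> {a..b-1}" by auto
  ultimately show "(\<Sum>v\<in>{a..b}. f v) = f a + (\<Sum>v\<in>{a+1..b}. f v)"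
    "(\<Sum>v\<in>{a..b}. f v) = f b + (\<Sum>v\<in>{a..b-1}. f v)"
    by (metis sum.insert finite_atLeastAtMost_int)+
qed

text \<open>An interval can lose a particle only if \<open>x\<close> is one of its ends, and then it
  has one to spare: the particles at \<open>x\<close> number at least two, and the remaining sites
  obey the bound for a shorter interval. With \<open>x\<close> strictly inside nothing leaves, and
  without \<open>x\<close> the interval can only gain. One-site intervals need no particle at
  all.\<close>

lemma spread_apply_instr:
  assumes "spread l r n \<eta>" and x: "2 \<le> \<eta> x"
  shows "\<exists>l' r'. spread l' r' n (apply_instr a x \<eta>)"
proof -
  define L R where "L = left_moves a" and "R = right_moves a"
  define \<eta>' where "\<eta>' = apply_instr a x \<eta>"
  have LR: "L = 0 \<or> L = 1" "R = 0 \<or> R = 1"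
    using moves_cases by (auto simp: L_def R_def)
  have sp: "l \<le> 0" "0 \<le> r" "\<And>v. v \<notin> {l..r} \<Longrightarrow> \<eta> v = 0" "0 < \<eta> l" "0 < \<eta> r"
     "(\<Sum>v\<in>{l..r}. int (\<eta> v)) = int n"
     "\<And>a b. l \<le> a \<Longrightarrow> a \<le> b \<Longrightarrow> b \<le> r \<Longrightarrow> b - a \<le> (\<Sum>v\<in>{a..b}. int (\<eta> v))"
    using assms(1) unfolding spread_def by blast+
  have xlr: "l \<le> x" "x \<le> r" using sp(3)[of x] x by force+
  have pt: "int (\<eta>' v) = int (\<eta> v) - (L + R) * of_bool (v = x)
           + L * of_bool (v = x - 1) + R * of_bool (v = x + 1)" for v
    unfolding \<eta>'_def L_def R_def by (rule int_apply_instr) (rule x)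
  have sm: "(\<Sum>v\<in>{c..d}. int (\<eta>' v)) = (\<Sum>v\<in>{c..d}. int (\<eta> v)) - (L + R) * of_bool (x \<in> {c..d})
           + L * of_bool (x - 1 \<in> {c..d}) + R * of_bool (x + 1 \<in> {c..d})" for c d
    using sum_apply_instr[of \<eta> x "{c..d}" "\<lambda>_. 1" a] x by (simp add: \<eta>'_def L_def R_def)
  \<comment> \<open>An end moves outward exactly when it topples outward. Otherwise a toppling end
    loses at most one of its two or more particles and stays occupied.\<close>
  define l' r' where "l' = (if x = l \<and> L = 1 then l - 1 else l)"
    and "r' = (if x = r \<and> R = 1 then r + 1 else r)"
  have ext: "(\<Sum>v\<in>{c..d}. int (\<eta> v)) = (\<Sum>v\<in>{max c l..min d r}. int (\<eta> v))" for c d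
    by (rule sum.mono_neutral_right) (use sp(3) in auto)
  have low: "d - c + of_bool (x = c \<or> x = d) \<le> (\<Sum>v\<in>{c..d}. int (\<eta> v))"
    if "l \<le> c" "c \<le> d" "d \<le> r" "c < d" for c d
  proof -
    consider "x = c" | "x = d" | "x \<noteq> c" "x \<noteq> d" by auto
    then show ?thesis
    proof cases
      case 1
      have "d - (c + 1) \<le> (\<Sum>v\<in>{c+1..d}. int (\<eta> v))" by (rule sp(7)) (use that in auto)
      moreover have "of_bool (x = c \<or> x = d) \<le> (1::int)" by simp
      ultimately show ?thesis using sum_int_interval_split(1)[of c d "\<lambda>v. int (\<eta> v)"] x[unfolded 1] that(2) by linarith
    next
      case 2
      have "d - 1 - c \<le> (\<Sum>v\<in>{c..d-1}. int (\<eta> v))" by (rule sp(7)) (use that in auto)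
      moreover have "of_bool (x = c \<or> x = d) \<le> (1::int)" by simp
      ultimately show ?thesis using sum_int_interval_split(2)[of c d "\<lambda>v. int (\<eta> v)"] x[unfolded 2] that(2) by linarith
    qed (use sp(7)[of c d] that in auto)
  qed
  have key: "d - c \<le> (\<Sum>v\<in>{c..d}. int (\<eta>' v))" if cd: "l' \<le> c" "c \<le> d" "d \<le> r'" for c d
  proof (cases "c = d")
    case True
    then show ?thesis by (simp add: sum_nonneg)
  next
    case False
    define s where "s = (\<Sum>v\<in>{c..d}. int (\<eta> v))"
    have lt: "c < d" using False cd by simp
    have single: "2 \<le> (\<Sum>v\<in>{x..x}. int (\<eta> v))" using x by simp
    \<comment> \<open>The cases record which ends of the interval are newly reached sites. These
      were empty before, so \<open>ext\<close> cuts the old count down to the old support.\<close>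
    consider "l \<le> c" "d \<le> r" | "c < l" "d \<le> r" | "l \<le> c" "r < d" | "c < l" "r < d" by linarith
    then show ?thesis
    proof cases
      case 1
      then have "d - c + of_bool (x = c \<or> x = d) \<le> s" unfolding s_def using low lt by simp
      then show ?thesis unfolding sm s_def[symmetric] of_bool_def using LR lt by auto
    next
      case 2
      have c: "x = l" "L = 1" using cd(1) 2(1) unfolding l'_def by (auto split: if_split_asm)
      then have c': "c = l - 1" using cd(1) 2(1) unfolding l'_def by simp
      have e: "s = (\<Sum>v\<in>{l..d}. int (\<eta> v))" unfolding s_def using ext[of c d] 2 by (simp add: max_def min_def)
      have "d - l + 1 \<le> s \<and> (d = l \<longrightarrow> 2 \<le> s)"
      proof (cases "d = l")
        case True
        then show ?thesis unfolding e using single c(1) by simp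
      next
        case False
        then have "l < d" using lt c' by simp
        then have "d - l + of_bool (x = l \<or> x = d) \<le> s" unfolding e using low[of l d] 2 by simp
        then show ?thesis using c(1) False by simp
      qed
      then show ?thesis unfolding sm s_def[symmetric] of_bool_def c(2) using LR(2) lt c(1) c' by auto
    next
      case 3
      have c: "x = r" "R = 1" using cd(3) 3(2) unfolding r'_def by (auto split: if_split_asm)
      then have c': "d = r + 1" using cd(3) 3(2) unfolding r'_def by simp
      have e: "s = (\<Sum>v\<in>{c..r}. int (\<eta> v))" unfolding s_def using ext[of c d] 3 by (simp add: max_def min_def)
      have "r - c + 1 \<le> s \<and> (c = r \<longrightarrow> 2 \<le> s)"
      proof (cases "c = r")
        case True
        then show ?thesis unfolding e using single c(1) by simp
      next
        case False
        then have "c < r" using lt c' by simp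
        then have "r - c + of_bool (x = c \<or> x = r) \<le> s" unfolding e using low[of c r] 3 by simp
        then show ?thesis using c(1) False by simp
      qed
      then show ?thesis unfolding sm s_def[symmetric] of_bool_def c(2) using LR(1) lt c(1) c' by auto
    next
      case 4
      have c1: "x = l" "L = 1" using cd(1) 4(1) unfolding l'_def by (auto split: if_split_asm)
      have c2: "x = r" "R = 1" using cd(3) 4(2) unfolding r'_def by (auto split: if_split_asm)
      have c: "c = x - 1" "d = x + 1" using cd(1,3) 4 c1 c2 unfolding l'_def r'_def by simp_all
      have "s = (\<Sum>v\<in>{x..x}. int (\<eta> v))" unfolding s_def using ext[of c d] unfolding c c1(1)[symmetric] c2(1)[symmetric] by simp
      then have "2 \<le> s" using single by simp
      then show ?thesis unfolding sm s_def[symmetric] c1(2) c2(2) using c by simp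
    qed
  qed
  have out: "\<eta>' v = 0" if "v \<notin> {l'..r'}" for v
  proof -
    have "v \<notin> {l..r}" using that by (auto simp: l'_def r'_def split: if_splits)
    then have "\<eta> v = 0" by (rule sp(3))
    then have "int (\<eta>' v) = 0" unfolding pt[of v] using that LR xlr
      by (auto simp: l'_def r'_def split: if_split_asm)
    then show ?thesis by simp
  qed
  have "0 < int (\<eta>' l')" "0 < int (\<eta>' r')"
    unfolding pt using LR xlr sp(4,5) x by (auto simp: l'_def r'_def)
  then have pos: "0 < \<eta>' l'" "0 < \<eta>' r'" by auto
  have e: "(\<Sum>v\<in>{l'..r'}. int (\<eta> v)) = int n" unfolding ext[of l' r'] using sp(1,2,6)
    by (auto simp: l'_def r'_def max_def min_def)
  have total: "(\<Sum>v\<in>{l'..r'}. int (\<eta>' v)) = int n"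
    unfolding sm e using LR xlr by (auto simp: l'_def r'_def)
  have "l' \<le> 0" "0 \<le> r'" using sp(1,2) by (simp_all add: l'_def r'_def)
  then have "spread l' r' n \<eta>'"
    unfolding spread_def by (intro conjI allI impI pos total out key)
  then show ?thesis unfolding \<eta>'_def by blast
qed

lemma spread_bounds:
  assumes "spread l r n \<eta>"
  shows "r - l \<le> int n" "- int n \<le> l" "r \<le> int n"
proof -
  note lr = spreadD(1,2)[OF assms]
  have "r - l \<le> (\<Sum>v\<in>{l..r}. int (\<eta> v))" by (rule spreadD(7)[OF assms]) (use lr in auto)
  also have "\<dots> = int n" by (rule spreadD(6)[OF assms])
  finally show "r - l \<le> int n" .
  then show "- int n \<le> l" "r \<le> int n" using lr by linarith+
qed

lemma spread_boundary:
  assumes "spread l r n \<eta>"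
  shows "left_boundary \<eta> = l" "right_boundary \<eta> = r"
proof -
  have *: "\<eta> v > 0 \<Longrightarrow> l \<le> v \<and> v \<le> r" for v using spreadD(3)[OF assms, of v] by (cases "v < l \<or> r < v") auto
  have "l \<in> {v. 0 < \<eta> v}" "r \<in> {v. 0 < \<eta> v}" using spreadD[OF assms] by auto
  then show "left_boundary \<eta> = l" "right_boundary \<eta> = r"
    unfolding left_boundary_def right_boundary_def
    by (auto intro!: cInf_eq_minimum cSup_eq_maximum dest: *)
qed

section \<open>Dynamics driven by a word of instructions\<close>

definition topple :: "config \<Rightarrow> instr \<Rightarrow> config" where
  "topple \<eta> a = (if stable \<eta> then \<eta> else apply_instr a (leftmost_unstable \<eta>) \<eta>)"

text \<open>Feeding the instructions in the order of their use makes the configuration a function of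
  the word alone; sites and odometer are recovered from it later.\<close>

definition run :: "nat \<Rightarrow> instr list \<Rightarrow> config" where
  "run n w = foldl topple (\<lambda>v. n * delta 0 v) w"

lemma run_snoc: "run n (w @ [a]) = topple (run n w) a"
  by (simp add: run_def)

lemma spread_run: "0 < n \<Longrightarrow> \<exists>l r. spread l r n (run n w)"
proof (induction w rule: rev_induct)
  case Nil
  then show ?case using spread_init[of n] by (auto simp: run_def)
next
  case (snoc a w)
  then obtain l r where sp: "spread l r n (run n w)" by blast
  show ?case
  proof (cases "stable (run n w)")
    case True
    then show ?thesis using sp by (auto simp: run_snoc topple_def)
  next
    case False
    then show ?thesis
      using spread_apply_instr[OF sp spread_leftmost_unstable[OF sp False]]
      by (simp add: run_snoc topple_def)
  qed
qed

text \<open>The window is one site larger than the possible supports, so that a toppling at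
  any occupied site stays inside it.\<close>

definition moment :: "nat \<Rightarrow> nat \<Rightarrow> config \<Rightarrow> int" where
  "moment k n \<eta> = (\<Sum>v\<in>{- int n - 1..int n + 1}. v ^ k * int (\<eta> v))"

lemma moment_spread:
  assumes "spread l r n \<eta>"
  shows "moment k n \<eta> = (\<Sum>v\<in>{l..r}. v ^ k * int (\<eta> v))"
  unfolding moment_def
  by (rule sum.mono_neutral_right) (use assms spread_bounds[OF assms] in \<open>auto intro!: spreadD(3)[OF assms]\<close>)

lemma moment_apply_instr:
  assumes "spread l r n \<eta>" "2 \<le> \<eta> x"
  shows "moment k n (apply_instr a x \<eta>) = moment k n \<eta>
    + left_moves a * ((x - 1) ^ k - x ^ k) + right_moves a * ((x + 1) ^ k - x ^ k)"
proof -
  have "\<not> (x < l \<or> r < x)" using spreadD(3)[OF assms(1), of x] assms(2) by auto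
  then have "- int n \<le> x" "x \<le> int n" using spread_bounds[OF assms(1)] by auto
  then show ?thesis unfolding moment_def
    by (subst sum_apply_instr) (use assms(2) in \<open>auto simp: algebra_simps\<close>)
qed

section \<open>Moments of spread and of stable configurations\<close>

lemma moment_2_bounds:
  assumes "spread l r n \<eta>"
  shows "0 \<le> moment 2 n \<eta>" "moment 2 n \<eta> \<le> int n ^ 3"
proof -
  have m: "moment 2 n \<eta> = (\<Sum>v\<in>{l..r}. v\<^sup>2 * int (\<eta> v))" by (rule moment_spread[OF assms])
  show "0 \<le> moment 2 n \<eta>" unfolding m by (rule sum_nonneg) auto
  have "moment 2 n \<eta> \<le> (\<Sum>v\<in>{l..r}. (int n)\<^sup>2 * int (\<eta> v))" unfolding m
  proof (intro sum_mono mult_right_mono)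
    fix v assume "v \<in> {l..r}"
    then have "\<bar>v\<bar> \<le> \<bar>int n\<bar>" using spread_bounds[OF assms] by auto
    then show "v\<^sup>2 \<le> (int n)\<^sup>2" by (simp only: abs_le_square_iff)
  qed auto
  also have "\<dots> = int n ^ 3"
    by (simp add: spreadD(6)[OF assms] sum_distrib_left[symmetric] power3_eq_cube power2_eq_square)
  finally show "moment 2 n \<eta> \<le> int n ^ 3" .
qed

text \<open>With \<open>N = r - l + 1\<close> sites and centre \<open>c = (l + r) / 2\<close>, the
  square sum is \<open>N * c^2\<close> plus the centred part \<open>(N^3 - N) / 12\<close>; the
  factor 12 keeps the identity in the integers.\<close>

lemma sum_int_interval:
  fixes l r :: int
  assumes "l \<le> r + 1"
  shows "2 * (\<Sum>v\<in>{l..r}. v) = (l + r) * (r - l + 1)"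
    "12 * (\<Sum>v\<in>{l..r}. v\<^sup>2) = 3 * (r - l + 1) * (l + r)\<^sup>2 + (r - l + 1) ^ 3 - (r - l + 1)"
proof -
  have "2 * (\<Sum>v\<in>{l..l - 1 + int m}. v) = (2 * l - 1 + int m) * int m \<and>
    12 * (\<Sum>v\<in>{l..l - 1 + int m}. v\<^sup>2) = 3 * int m * (2 * l - 1 + int m)\<^sup>2 + int m ^ 3 - int m" for m
  proof (induction m)
    case (Suc m)
    have "{l..l - 1 + int (Suc m)} = insert (l + int m) {l..l - 1 + int m}" by auto
    then show ?case using Suc by (simp add: algebra_simps power2_eq_square power3_eq_cube)
  qed auto
  from this[of "nat (r - l + 1)"] assms
  show "2 * (\<Sum>v\<in>{l..r}. v) = (l + r) * (r - l + 1)"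
    "12 * (\<Sum>v\<in>{l..r}. v\<^sup>2) = 3 * (r - l + 1) * (l + r)\<^sup>2 + (r - l + 1) ^ 3 - (r - l + 1)"
    by (auto simp: algebra_simps)
qed

text \<open>Stability makes each \<open>1 - \<eta> v\<close> nonnegative, and \<open>spread\<close>
  bounds their sum by one, so there is at most one hole. Filling it turns moments into power sums
  over an interval, at a cost of at most \<open>n ^ k\<close> because no site exceeds
  \<open>n\<close> in modulus.\<close>

lemma stable_spread_moments:
  assumes sp: "spread l r n \<eta>" and st: "stable \<eta>"
  shows "r - l + 1 = int n \<or> r - l + 1 = int n + 1"
    "\<bar>(l + r) * (r - l + 1) - 2 * moment 1 n \<eta>\<bar> \<le> 2 * int n"
    "\<bar>3 * (r - l + 1) * (l + r)\<^sup>2 + (r - l + 1) ^ 3 - (r - l + 1) - 12 * moment 2 n \<eta>\<bar> \<le> 12 * (int n)\<^sup>2"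
proof -
  have tot: "(\<Sum>v\<in>{l..r}. int (\<eta> v)) = int n" and lr: "l \<le> 0" "0 \<le> r"
    by (rule spreadD[OF sp])+
  have hn: "0 \<le> 1 - int (\<eta> v)" for v
    using st by (auto simp: stable_def stable_at_def)
  have holes: "(\<Sum>v\<in>{l..r}. 1 - int (\<eta> v)) = r - l + 1 - int n"
    using tot lr by (simp add: sum_subtractf)
  moreover have "0 \<le> (\<Sum>v\<in>{l..r}. 1 - int (\<eta> v))" by (rule sum_nonneg) (rule hn)
  ultimately show N: "r - l + 1 = int n \<or> r - l + 1 = int n + 1"
    using spread_bounds[OF sp] by auto
  have gap: "\<bar>(\<Sum>v\<in>{l..r}. v ^ k) - moment k n \<eta>\<bar> \<le> int n ^ k" for k
  proof -
    have "(\<Sum>v\<in>{l..r}. v ^ k) - moment k n \<eta> = (\<Sum>v\<in>{l..r}. v ^ k * (1 - int (\<eta> v)))"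
      by (simp add: moment_spread[OF sp] sum_subtractf algebra_simps)
    also have "\<bar>\<dots>\<bar> \<le> (\<Sum>v\<in>{l..r}. int n ^ k * (1 - int (\<eta> v)))"
    proof (rule order_trans[OF sum_abs], rule sum_mono)
      fix v assume "v \<in> {l..r}"
      then have "\<bar>v\<bar> \<le> int n" using spread_bounds[OF sp] by auto
      then show "\<bar>v ^ k * (1 - int (\<eta> v))\<bar> \<le> int n ^ k * (1 - int (\<eta> v))"
        using hn[of v] by (auto simp: abs_mult power_abs intro!: mult_right_mono power_mono)
    qed
    also have "\<dots> = int n ^ k * (r - l + 1 - int n)" by (simp only: sum_distrib_left[symmetric] holes)
    also have "\<dots> \<le> int n ^ k" using N by auto
    finally show ?thesis .
  qed
  show "\<bar>(l + r) * (r - l + 1) - 2 * moment 1 n \<eta>\<bar> \<le> 2 * int n"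
    using gap[of 1] sum_int_interval(1)[of l r] lr unfolding power_one_right by linarith
  show "\<bar>3 * (r - l + 1) * (l + r)\<^sup>2 + (r - l + 1) ^ 3 - (r - l + 1) - 12 * moment 2 n \<eta>\<bar> \<le> 12 * (int n)\<^sup>2"
    using gap[of 2] sum_int_interval(2)[of l r] lr by linarith
qed

text \<open>The length is known up to one, so the centre determines both ends, and the centre is
  nearly the first moment divided by \<open>n\<close>. The third bound retains the squared first
  moment, since no pointwise bound on the centre would be good enough.\<close>

lemma stable_boundary_estimate:
  assumes sp: "spread l r n \<eta>" and st: "stable \<eta>" and n: "0 < n"
  shows "\<bar>real_of_int l + real n / 2 - real_of_int (moment 1 n \<eta>) / real n\<bar> \<le> 3"
    "\<bar>real_of_int r - real n / 2 - real_of_int (moment 1 n \<eta>) / real n\<bar> \<le> 3"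
    "\<bar>real_of_int (moment 2 n \<eta>) - real n ^ 3 / 12\<bar>
       \<le> 4 * (real n)\<^sup>2 + 2 * (real_of_int (moment 1 n \<eta>))\<^sup>2 / real n"
proof -
  define P Q where "P = real_of_int (moment 1 n \<eta>)" and "Q = real_of_int (moment 2 n \<eta>)"
  define N where "N = r - l + 1"
  define c where "c = real_of_int (l + r) / 2"
  note b = spread_bounds[OF sp]
  note m = stable_spread_moments[OF sp st, folded N_def]
  note lr = spreadD(1,2)[OF sp]
  have N: "real_of_int N = real n \<or> real_of_int N = real n + 1" using m(1) by auto
  have "\<bar>l + r\<bar> \<le> int n" using b lr by auto
  then have "real_of_int \<bar>l + r\<bar> \<le> real_of_int (int n)" by (simp only: of_int_le_iff)
  then have cb: "\<bar>c\<bar> \<le> real n / 2" unfolding c_def by simp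
  have "real_of_int \<bar>(l + r) * N - 2 * moment 1 n \<eta>\<bar> \<le> real_of_int (2 * int n)"
    using m(2) by (simp only: of_int_le_iff)
  then have cP: "\<bar>c * N - P\<bar> \<le> real n" by (simp add: c_def P_def abs_le_iff field_simps)
  \<comment> \<open>Replacing \<open>N\<close> by \<open>n\<close> costs at most
    \<open>\<bar>c\<bar>\<close>, hence at most half of \<open>n\<close>. The half-length
    \<open>(N - 1) / 2\<close> differs from \<open>n / 2\<close> by at most 1/2, which leads to the
    constant 3.\<close>
  have "\<bar>c * n - P\<bar> \<le> 2 * real n" using N cP cb by (auto simp: algebra_simps abs_le_iff)
  then have "\<bar>(c * n - P) / n\<bar> \<le> 2" using n by (simp add: abs_divide field_simps)
  define z where "z = P / n"
  then have e: "\<bar>c - z\<bar> \<le> 2" using n \<open>\<bar>(c * n - P) / n\<bar> \<le> 2\<close> by (simp add: diff_divide_distrib)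
  have "real_of_int l = c - (real_of_int N - 1) / 2" "real_of_int r = c + (real_of_int N - 1) / 2"
    by (auto simp: c_def N_def field_simps)
  then show "\<bar>real_of_int l + real n / 2 - real_of_int (moment 1 n \<eta>) / real n\<bar> \<le> 3"
    "\<bar>real_of_int r - real n / 2 - real_of_int (moment 1 n \<eta>) / real n\<bar> \<le> 3"
    using e N unfolding P_def[symmetric] z_def[symmetric] abs_le_iff by (auto simp: field_simps)
  have "real_of_int \<bar>3 * N * (l + r)\<^sup>2 + N ^ 3 - N - 12 * moment 2 n \<eta>\<bar> \<le> real_of_int (12 * (int n)\<^sup>2)"
    using m(3) by (simp only: of_int_le_iff)
  then have q: "\<bar>N * c\<^sup>2 + (real_of_int N ^ 3 - N) / 12 - Q\<bar> \<le> (real n)\<^sup>2"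
    by (simp add: c_def Q_def abs_le_iff field_simps)
  have n1: "real n \<ge> 1" using n by auto
  have n2: "real n \<le> (real n)\<^sup>2" using mult_left_mono[OF n1, of "real n"] by (simp add: power2_eq_square)
  have cube: "\<bar>(real_of_int N ^ 3 - N) / 12 - real n ^ 3 / 12\<bar> \<le> (real n)\<^sup>2 / 2"
    using N
  proof
    assume N0: "real_of_int N = real n"
    have "(real_of_int N ^ 3 - N) / 12 - real n ^ 3 / 12 = - real n / 12"
      unfolding N0 by (simp add: field_simps)
    then show ?thesis using n1 n2 by linarith
  next
    assume N1: "real_of_int N = real n + 1"
    have "(real_of_int N ^ 3 - N) / 12 - real n ^ 3 / 12 = (real n)\<^sup>2 / 4 + real n / 6"
      unfolding N1 by (simp add: power3_eq_cube power2_eq_square algebra_simps)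
    then show ?thesis using n1 n2 by linarith
  qed
  have Nn: "real n \<le> N" using N by auto
  \<comment> \<open>The product \<open>c * N\<close> is within \<open>n\<close> of \<open>P\<close>,
    so its square is at most twice the sum of the squares of \<open>P\<close> and
    \<open>n\<close>.\<close>
  have "N * c\<^sup>2 = (c * N)\<^sup>2 / N" using Nn n1 by (simp add: power2_eq_square)
  also have "\<dots> \<le> (c * N)\<^sup>2 / n" using Nn n1 by (intro divide_left_mono) auto
  also have "(c * N)\<^sup>2 \<le> 2 * P\<^sup>2 + 2 * (real n)\<^sup>2"
  proof -
    have "(c * N)\<^sup>2 \<le> 2 * P\<^sup>2 + 2 * (c * N - P)\<^sup>2"
      using zero_le_power2[of "c * N - 2 * P"] by (simp add: power2_eq_square algebra_simps)
    moreover have "(c * N - P)\<^sup>2 \<le> (real n)\<^sup>2" using cP by (simp add: abs_le_square_iff[symmetric])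
    ultimately show ?thesis by simp
  qed
  then have "(c * N)\<^sup>2 / n \<le> (2 * P\<^sup>2 + 2 * (real n)\<^sup>2) / n" by (rule divide_right_mono) auto
  also have "\<dots> = 2 * P\<^sup>2 / n + 2 * real n" using n by (simp add: field_simps power2_eq_square)
  finally have u: "N * c\<^sup>2 \<le> 2 * P\<^sup>2 / n + 2 * real n" .
  have l0: "0 \<le> N * c\<^sup>2" using Nn by simp
  have l1: "0 \<le> 2 * P\<^sup>2 / n" by simp
  show "\<bar>real_of_int (moment 2 n \<eta>) - real n ^ 3 / 12\<bar>
       \<le> 4 * (real n)\<^sup>2 + 2 * (real_of_int (moment 1 n \<eta>))\<^sup>2 / real n"
    unfolding P_def[symmetric] Q_def[symmetric]
    using u l0 l1 q cube n2 by linarith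
qed

subsection \<open>Adaptive exploration of an independent family\<close>

text \<open>Each term sees the letters already read and the new one. If its mean over the new letter
  vanishes, this is a martingale; this form covers all processes used below.\<close>

definition acc :: "('c list \<Rightarrow> 'c \<Rightarrow> 'b::comm_monoid_add) \<Rightarrow> 'c list \<Rightarrow> 'b" where
  "acc f w = (\<Sum>j<length w. f (take j w) (w ! j))"

lemma acc_Nil [simp]: "acc f [] = 0"
  by (simp add: acc_def)

lemma acc_snoc [simp]: "acc f (w @ [a]) = acc f w + f w a"
  by (simp add: acc_def nth_append)

lemma acc_diff: "acc (\<lambda>w a. f w a - g w a) w = acc f w - acc g w"
  for f :: "'c list \<Rightarrow> 'c \<Rightarrow> real"
  by (simp add: acc_def sum_subtractf)

lemma acc_cmult: "acc (\<lambda>w a. c * f w a) w = c * acc f w"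
  for f :: "'c list \<Rightarrow> 'c \<Rightarrow> real"
  by (simp add: acc_def sum_distrib_left)

lemma acc_mono:
  fixes f :: "'c list \<Rightarrow> 'c \<Rightarrow> real"
  shows "(\<And>w a. f w a \<le> g w a) \<Longrightarrow> acc f w \<le> acc g w"
  unfolding acc_def by (rule sum_mono)

text \<open>By \<open>fresh\<close>, the event that the explored values spell a given word is an intersection of events for
  distinct members of the family, which are determined by the word.\<close>

locale exploration = prob_space M for M :: "'a measure" +
  fixes X :: "'i \<Rightarrow> 'a \<Rightarrow> 'c::finite" and q :: "'c \<Rightarrow> real" and pick :: "'c list \<Rightarrow> 'i"
  assumes indep: "indep_vars (\<lambda>_. count_space UNIV) X UNIV"
    and law: "prob {\<omega> \<in> space M. X i \<omega> = a} = q a"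
    and fresh: "v \<noteq> [] \<Longrightarrow> pick (w @ v) \<noteq> pick w"
begin

primrec hist :: "nat \<Rightarrow> 'a \<Rightarrow> 'c list" where
  "hist 0 \<omega> = []"
| "hist (Suc k) \<omega> = hist k \<omega> @ [X (pick (hist k \<omega>)) \<omega>]"

lemma length_hist [simp]: "length (hist k \<omega>) = k"
  by (induction k) auto

lemma hist_eq_iff: "hist (length w) \<omega> = w \<longleftrightarrow> (\<forall>i<length w. X (pick (take i w)) \<omega> = w ! i)"
proof (induction w rule: rev_induct)
  case (snoc a w)
  show ?case using snoc by (auto simp: less_Suc_eq nth_append)
qed auto

lemma inj_on_pick_take: "inj_on (\<lambda>i. pick (take i w)) {..<length w}"
proof (rule linorder_inj_onI)
  fix i j assume ij: "i < j" "i \<in> {..<length w}" "j \<in> {..<length w}"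
  have "take j w = take i w @ take (j - i) (drop i w)"
    using ij(1) by (metis le_add_diff_inverse less_imp_le take_add)
  moreover have "take (j - i) (drop i w) \<noteq> []" using ij by auto
  ultimately show "pick (take i w) \<noteq> pick (take j w)" using fresh by metis
qed auto

lemma X_measurable [measurable]: "X i \<in> measurable M (count_space UNIV)"
  using indep by (auto simp: indep_vars_def)

lemma hist_sets: "{\<omega> \<in> space M. hist (length w) \<omega> = w} \<in> sets M"
  unfolding hist_eq_iff by measurable

lemma prob_hist: "prob {\<omega> \<in> space M. hist (length w) \<omega> = w} = (\<Prod>a\<leftarrow>w. q a)"
proof (cases "w = []")
  case True
  then show ?thesis by (simp add: prob_space)
next
  case False
  define f where "f i = pick (take i w)" for i
  \<comment> \<open>Independence gives a product over members of the family, not over positions in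
    the word; the inverse of \<open>f\<close> assigns to each member the letter it must
    take.\<close>
  define A where "A j = {w ! inv_into {..<length w} f j}" for j
  have inj: "inj_on f {..<length w}" unfolding f_def by (rule inj_on_pick_take)
  have A: "A (f i) = {w ! i}" if "i < length w" for i
    using inj that by (simp add: A_def)
  have "{\<omega> \<in> space M. hist (length w) \<omega> = w} = (\<Inter>j\<in>f ` {..<length w}. X j -` A j \<inter> space M)"
    unfolding hist_eq_iff using False A by (auto simp: f_def[symmetric])
  also have "prob \<dots> = (\<Prod>j\<in>f ` {..<length w}. prob (X j -` A j \<inter> space M))"
    by (rule indep_varsD[OF indep]) (use False in auto)
  also have "\<dots> = (\<Prod>i<length w. prob (X (f i) -` A (f i) \<inter> space M))"
    using inj by (simp add: prod.reindex)
  also have "\<dots> = (\<Prod>i<length w. q (w ! i))"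
  proof (rule prod.cong)
    fix i assume "i \<in> {..<length w}"
    then have "X (f i) -` A (f i) \<inter> space M = {\<omega> \<in> space M. X (f i) \<omega> = w ! i}"
      using A by auto
    then show "prob (X (f i) -` A (f i) \<inter> space M) = q (w ! i)" using law by simp
  qed simp
  also have "\<dots> = (\<Prod>a\<leftarrow>w. q a)"
    by (simp add: prod.list_conv_set_nth atLeast0LessThan)
  finally show ?thesis .
qed

lemma hist_measurable [measurable]: "hist k \<in> measurable M (count_space UNIV)"
proof (subst measurable_count_space_eq_countable)
  show "countable (UNIV :: 'c list set)" by simp
  have "hist k -` {w} \<inter> space M \<in> sets M" for w
  proof (cases "length w = k")
    case True
    then show ?thesis using hist_sets[of w]
      by (auto simp: vimage_def Int_def conj_commute)
  next
    case False
    then have "hist k -` {w} \<inter> space M = {}" by auto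
    then show ?thesis by simp
  qed
  then show "hist k \<in> space M \<rightarrow> UNIV \<and> (\<forall>w\<in>UNIV. hist k -` {w} \<inter> space M \<in> sets M)" by simp
qed

section \<open>Expectations of functions of the history\<close>

abbreviation words :: "nat \<Rightarrow> 'c list set" where
  "words k \<equiv> {w. length w = k}"

lemma finite_words: "finite (words k)"
  using finite_lists_length_eq[of "UNIV :: 'c set" k] by simp

lemma integrable_hist:
  fixes F :: "'c list \<Rightarrow> 'b::{banach, second_countable_topology}"
  shows "integrable M (\<lambda>\<omega>. F (hist k \<omega>))"
proof (rule integrable_const_bound)
  show "AE \<omega> in M. norm (F (hist k \<omega>)) \<le> (\<Sum>w\<in>words k. norm (F w))"
    using finite_words[of k] by (auto intro!: member_le_sum)
  show "(\<lambda>\<omega>. F (hist k \<omega>)) \<in> borel_measurable M"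
    by (rule measurable_compose[OF hist_measurable]) simp
qed

text \<open>The range is a general Banach space because both real statistics and complex
  exponentials are averaged.\<close>

definition expect :: "nat \<Rightarrow> ('c list \<Rightarrow> 'b::{banach, second_countable_topology}) \<Rightarrow> 'b" where
  "expect k F = (LINT \<omega>|M. F (hist k \<omega>))"

lemma expect_eq_sum: "expect k F = (\<Sum>w\<in>words k. (\<Prod>a\<leftarrow>w. q a) *\<^sub>R F w)"
proof -
  have "expect k F = (LINT \<omega>|M. (\<Sum>w\<in>words k. indicator {\<omega> \<in> space M. hist k \<omega> = w} \<omega> *\<^sub>R F w))"
    unfolding expect_def
  proof (rule Bochner_Integration.integral_cong)
    fix \<omega> assume "\<omega> \<in> space M"
    then have "(\<Sum>w\<in>words k. indicator {\<omega> \<in> space M. hist k \<omega> = w} \<omega> *\<^sub>R F w)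
      = (\<Sum>w\<in>words k. if hist k \<omega> = w then F w else 0)"
      by (intro sum.cong) (auto simp: indicator_def)
    also have "\<dots> = F (hist k \<omega>)" using finite_words by simp
    finally show "F (hist k \<omega>) = (\<Sum>w\<in>words k. indicator {\<omega> \<in> space M. hist k \<omega> = w} \<omega> *\<^sub>R F w)" by simp
  qed simp
  also have "\<dots> = (\<Sum>w\<in>words k. LINT \<omega>|M. indicator {\<omega> \<in> space M. hist k \<omega> = w} \<omega> *\<^sub>R F w)"
  proof (rule Bochner_Integration.integral_sum)
    fix w assume "w \<in> words k"
    then show "integrable M (\<lambda>\<omega>. indicator {\<omega> \<in> space M. hist k \<omega> = w} \<omega> *\<^sub>R F w)"
      using hist_sets[of w] by (intro integrable_scaleR_left) (auto simp: integrable_indicator_iff emeasure_eq_measure)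
  qed
  also have "\<dots> = (\<Sum>w\<in>words k. (\<Prod>a\<leftarrow>w. q a) *\<^sub>R F w)"
  proof (rule sum.cong)
    fix w assume "w \<in> words k"
    then show "(LINT \<omega>|M. indicator {\<omega> \<in> space M. hist k \<omega> = w} \<omega> *\<^sub>R F w) = (\<Prod>a\<leftarrow>w. q a) *\<^sub>R F w"
      using hist_sets[of w] prob_hist[of w]
      by (subst integral_scaleR_left) (auto simp: integrable_indicator_iff emeasure_eq_measure Int_def conj_commute)
  qed simp
  finally show ?thesis .
qed

lemma expect_0: "expect 0 F = F []"
  by (simp add: expect_def prob_space)

text \<open>The weight of \<open>w @ [a]\<close> factors into that of \<open>w\<close> and
  \<open>q a\<close>. This is the tower property, and it stands in for conditional
  expectations.\<close>

lemma expect_Suc: "expect (Suc k) F = expect k (\<lambda>w. \<Sum>a\<in>UNIV. q a *\<^sub>R F (w @ [a]))"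
proof -
  have words: "words (Suc k) = (\<lambda>(w, a). w @ [a]) ` (words k \<times> UNIV)"
  proof (intro equalityI subsetI)
    fix w :: "'c list" assume "w \<in> words (Suc k)"
    then have "w = butlast w @ [last w]" "length (butlast w) = k"
      by (auto intro!: append_butlast_last_id[symmetric])
    then show "w \<in> (\<lambda>(w, a). w @ [a]) ` (words k \<times> UNIV)"
      by (intro image_eqI[of _ _ "(butlast w, last w)"]) simp_all
  qed auto
  have inj: "inj_on (\<lambda>(w, a). w @ [a :: 'c]) (words k \<times> UNIV)"
    by (auto simp: inj_on_def)
  show ?thesis
    unfolding expect_eq_sum words sum.reindex[OF inj]
    by (simp add: sum.cartesian_product scaleR_sum_right case_prod_unfold)
qed

lemma sum_q: "(\<Sum>a\<in>UNIV. q a) = 1"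
  using expect_Suc[of 0 "\<lambda>_. 1 :: real"] expect_0[of "\<lambda>_. \<Sum>a\<in>UNIV. q a *\<^sub>R (1::real)"]
  by (simp add: expect_def prob_space)

lemma expect_add: "expect k (\<lambda>w. F w + G w) = expect k F + expect k G"
  unfolding expect_def by (intro Bochner_Integration.integral_add integrable_hist)

lemma expect_mono:
  fixes F G :: "'c list \<Rightarrow> real"
  assumes "\<And>w. length w = k \<Longrightarrow> F w \<le> G w"
  shows "expect k F \<le> expect k G"
  unfolding expect_def by (intro integral_mono integrable_hist) (simp add: assms)

lemma expect_cong:
  assumes "\<And>w. length w = k \<Longrightarrow> F w = G w"
  shows "expect k F = expect k G"
  unfolding expect_def by (intro Bochner_Integration.integral_cong) (simp_all add: assms)

lemma expect_cmult: "expect k (\<lambda>w. c * F w) = c * expect k F" for c :: real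
  unfolding expect_def by simp

lemma expect_const: "expect k (\<lambda>_. c) = c" for c :: real
  unfolding expect_def by (simp add: prob_space)

text \<open>Each term may be replaced by its mean over the new letter: this is the compensator of
  the process.\<close>

lemma expect_acc:
  fixes f :: "'c list \<Rightarrow> 'c \<Rightarrow> real"
  shows "expect k (acc f) = expect k (acc (\<lambda>w _. \<Sum>a\<in>UNIV. q a * f w a))"
proof (induction k)
  case 0
  then show ?case by (simp add: expect_0)
next
  case (Suc k)
  have *: "(\<Sum>a\<in>UNIV. q a * (x + g a)) = x + (\<Sum>a\<in>UNIV. q a * g a)" for x and g :: "'c \<Rightarrow> real"
    by (simp add: distrib_left sum.distrib sum_distrib_right[symmetric] sum_q)
  have **: "(\<Sum>a\<in>UNIV. q a * g) = g" for g
    by (simp add: sum_distrib_right[symmetric] sum_q)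
  show ?case by (simp add: expect_Suc * ** expect_add Suc)
qed

text \<open>Martingale increments are orthogonal: averaging over the last letter kills the cross
  term.\<close>

lemma expect_acc_square:
  fixes f :: "'c list \<Rightarrow> 'c \<Rightarrow> real"
  assumes centered: "\<And>w. (\<Sum>a\<in>UNIV. q a * f w a) = 0"
  shows "expect k (\<lambda>w. (acc f w)\<^sup>2) = expect k (acc (\<lambda>w a. (f w a)\<^sup>2))"
proof (induction k)
  case 0
  then show ?case by (simp add: expect_0)
next
  case (Suc k)
  have l: "(\<Sum>a\<in>UNIV. q a * (x + f w a)\<^sup>2) = x\<^sup>2 + (\<Sum>a\<in>UNIV. q a * (f w a)\<^sup>2)" for x w
  proof -
    have "(\<Sum>a\<in>UNIV. q a * (x + f w a)\<^sup>2)
      = (\<Sum>a\<in>UNIV. q a * x\<^sup>2 + 2 * x * (q a * f w a) + q a * (f w a)\<^sup>2)"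
      by (intro sum.cong) (auto simp: power2_eq_square algebra_simps)
    also have "\<dots> = x\<^sup>2 * (\<Sum>a\<in>UNIV. q a) + 2 * x * (\<Sum>a\<in>UNIV. q a * f w a) + (\<Sum>a\<in>UNIV. q a * (f w a)\<^sup>2)"
      by (simp add: sum.distrib sum_distrib_left sum_distrib_right mult.commute)
    finally show ?thesis by (simp add: centered sum_q)
  qed
  have r: "(\<Sum>a\<in>UNIV. q a * (x + g a)) = x + (\<Sum>a\<in>UNIV. q a * g a)" for x and g :: "'c \<Rightarrow> real"
    by (simp add: distrib_left sum.distrib sum_distrib_right[symmetric] sum_q)
  show ?case by (simp add: expect_Suc l r expect_add Suc)
qed

text \<open>The variance of \<open>\<bar>F w\<bar>\<close> is nonnegative.\<close>

lemma expect_abs_le_sqrt: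
  fixes F :: "'c list \<Rightarrow> real"
  shows "expect k (\<lambda>w. \<bar>F w\<bar>) \<le> sqrt (expect k (\<lambda>w. (F w)\<^sup>2))"
proof -
  define m where "m = expect k (\<lambda>w. \<bar>F w\<bar>)"
  have "0 \<le> expect k (\<lambda>w. (\<bar>F w\<bar> - m)\<^sup>2)"
    unfolding expect_def by (rule integral_nonneg_AE) simp
  also have "(\<lambda>w. (\<bar>F w\<bar> - m)\<^sup>2) = (\<lambda>w. (F w)\<^sup>2 + ((- 2 * m) * \<bar>F w\<bar> + m\<^sup>2))"
    by (simp add: power2_diff fun_eq_iff)
  finally have "m\<^sup>2 \<le> expect k (\<lambda>w. (F w)\<^sup>2)"
    by (simp only: expect_add expect_cmult expect_const m_def[symmetric]) (simp add: power2_eq_square)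
  then show ?thesis unfolding m_def[symmetric] by (rule real_le_rsqrt)
qed

end

subsection \<open>Instructions in the order of their use\<close>

lemma UNIV_instr: "UNIV = {ToLeft, ToRight, ToBoth, Nothing}"
  using instr.exhaust by auto

instance instr :: finite
  by standard (simp add: UNIV_instr)

text \<open>After stabilization the exploration continues with unused instructions at the origin, which do
  not affect the configuration. So the history is i.i.d. up to any deterministic time.\<close>

definition site :: "config \<Rightarrow> int" where
  "site \<eta> = (if stable \<eta> then 0 else leftmost_unstable \<eta>)"

text \<open>This counts all draws of the exploration, including those at the origin after
  stabilization.\<close>

definition odometer :: "nat \<Rightarrow> instr list \<Rightarrow> int \<Rightarrow> nat" where
  "odometer n w v = acc (\<lambda>w _. of_bool (v = site (run n w))) w"

definition next_index :: "nat \<Rightarrow> instr list \<Rightarrow> int \<times> nat" where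
  "next_index n w = (site (run n w), odometer n w (site (run n w)))"

lemma odometer_append_mono: "odometer n w x \<le> odometer n (w @ v) x"
  unfolding odometer_def
  by (induction v rule: rev_induct) (simp_all add: append.assoc[symmetric] del: append.assoc append_assoc)

text \<open>A draw raises the counter of its site, and counters never decrease, so no index can
  recur.\<close>

lemma next_index_fresh:
  assumes "v \<noteq> []"
  shows "next_index n (w @ v) \<noteq> next_index n w"
proof
  assume eq: "next_index n (w @ v) = next_index n w"
  define x where "x = site (run n w)"
  obtain a v' where v: "v = a # v'" using assms by (cases v) auto
  have "odometer n (w @ [a]) x = odometer n w x + 1"
    by (simp add: odometer_def x_def)
  moreover have "odometer n (w @ [a]) x \<le> odometer n (w @ v) x"
    using odometer_append_mono[of n "w @ [a]" x v'] by (simp add: v)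
  moreover have "odometer n (w @ v) x = odometer n w x"
    using eq unfolding next_index_def x_def by (metis prod.inject)
  ultimately show False by simp
qed

section \<open>Moments and number of steps as accumulated sums\<close>

definition active :: "nat \<Rightarrow> instr list \<Rightarrow> real" where
  "active n w = of_bool (\<not> stable (run n w))"

definition topples :: "nat \<Rightarrow> instr list \<Rightarrow> real" where
  "topples n w = acc (\<lambda>w _. active n w) w"

definition displacement :: "instr \<Rightarrow> real" where
  "displacement a = of_int (right_moves a - left_moves a)"

definition jumps :: "instr \<Rightarrow> real" where
  "jumps a = of_int (right_moves a + left_moves a)"

definition mom :: "nat \<Rightarrow> nat \<Rightarrow> instr list \<Rightarrow> real" where
  "mom k n w = real_of_int (moment k n (run n w))"

lemma displacement_simps [simp]:
  "displacement ToLeft = -1" "displacement ToRight = 1" "displacement ToBoth = 0" "displacement Nothing = 0"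
  by (auto simp: displacement_def left_moves_def right_moves_def)

lemma jumps_simps [simp]:
  "jumps ToLeft = 1" "jumps ToRight = 1" "jumps ToBoth = 2" "jumps Nothing = 0"
  by (auto simp: jumps_def left_moves_def right_moves_def)

lemma active_cases: "active n w = 0 \<or> active n w = 1"
  by (simp add: active_def)

lemma active_square [simp]: "(active n w)\<^sup>2 = active n w"
  by (simp add: active_def)

lemma active_bounds [simp]: "0 \<le> active n w" "active n w \<le> 1"
  by (auto simp: active_def)

lemma mom_Nil: "0 < n \<Longrightarrow> 0 < k \<Longrightarrow> mom k n [] = 0"
  using moment_spread[OF spread_init, of n k] by (simp add: mom_def run_def)

lemma mom_snoc:
  assumes "0 < n" and x: "x = site (run n w)"
  shows "mom k n (w @ [a]) = mom k n w + active n w *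
    (of_int (left_moves a) * ((of_int x - 1) ^ k - of_int x ^ k) +
     of_int (right_moves a) * ((of_int x + 1) ^ k - of_int x ^ k))"
proof -
  obtain l r where sp: "spread l r n (run n w)" using spread_run[OF assms(1)] by blast
  show ?thesis
  proof (cases "stable (run n w)")
    case False
    then show ?thesis
      using moment_apply_instr[OF sp spread_leftmost_unstable[OF sp False], of k a]
      by (simp add: mom_def run_snoc topple_def active_def x site_def)
  qed (simp add: mom_def run_snoc topple_def active_def)
qed

lemma mom_1_eq_acc:
  assumes "0 < n"
  shows "mom 1 n w = acc (\<lambda>w a. active n w * displacement a) w"
proof (induction w rule: rev_induct)
  case (snoc a w)
  show ?case using snoc mom_snoc[OF assms refl, of 1 w a]
    by (simp add: displacement_def algebra_simps)
qed (simp add: mom_Nil assms)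

text \<open>Moving one particle from \<open>x\<close> changes its square by \<open>2 * x + 1\<close>
  or \<open>- 2 * x + 1\<close>. The linear parts give a centred term, the ones count the moved
  particles, with mean \<open>2 * p\<close>.\<close>

lemma mom_2_eq_acc:
  assumes "0 < n"
  shows "mom 2 n w =
    acc (\<lambda>w a. active n w * (2 * real_of_int (site (run n w)) * displacement a + jumps a)) w"
proof (induction w rule: rev_induct)
  case (snoc a w)
  show ?case using snoc mom_snoc[OF assms refl, of 2 w a]
    by (simp add: displacement_def jumps_def power2_eq_square algebra_simps)
qed (simp add: mom_Nil assms)

lemma site_bound:
  assumes "0 < n"
  shows "\<bar>real_of_int (site (run n w))\<bar> \<le> real n"
proof -
  obtain l r where sp: "spread l r n (run n w)" using spread_run[OF assms] by blast
  have "\<bar>site (run n w)\<bar> \<le> int n"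
  proof (cases "stable (run n w)")
    case False
    then have "\<not> (site (run n w) < l \<or> r < site (run n w))"
      using spreadD(3)[OF sp, of "site (run n w)"] spread_leftmost_unstable[OF sp False]
      by (auto simp: site_def)
    then show ?thesis using spread_bounds[OF sp] by auto
  qed (simp add: site_def)
  then have "real_of_int \<bar>site (run n w)\<bar> \<le> real_of_int (int n)" by (simp only: of_int_le_iff)
  then show ?thesis by simp
qed

lemma mom_2_bounds:
  assumes "0 < n"
  shows "0 \<le> mom 2 n w" "mom 2 n w \<le> real n ^ 3"
proof -
  obtain l r where sp: "spread l r n (run n w)" using spread_run[OF assms] by blast
  show "0 \<le> mom 2 n w" using moment_2_bounds(1)[OF sp] by (simp add: mom_def)
  have "real_of_int (moment 2 n (run n w)) \<le> real_of_int (int n ^ 3)"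
    using moment_2_bounds(2)[OF sp] by (simp only: of_int_le_iff)
  then show "mom 2 n w \<le> real n ^ 3" by (simp add: mom_def)
qed

text \<open>In the stable case this is the boundary estimate; in the unstable case the trivial
  bounds 0 and \<open>n ^ 3\<close> suffice, since that case is rare at late times.\<close>

lemma mom_2_deviation:
  assumes "0 < n"
  shows "\<bar>mom 2 n w - real n ^ 3 / 12\<bar>
    \<le> 4 * (real n)\<^sup>2 + (2 / real n) * (mom 1 n w)\<^sup>2 + real n ^ 3 * active n w"
proof -
  obtain l r where sp: "spread l r n (run n w)" using spread_run[OF assms] by blast
  show ?thesis
  proof (cases "stable (run n w)")
    case True
    then show ?thesis
      using stable_boundary_estimate(3)[OF sp True assms] by (simp add: mom_def active_def)
  next
    case False
    have "0 \<le> 4 * (real n)\<^sup>2 + (2 / real n) * (mom 1 n w)\<^sup>2" by simp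
    moreover have "0 \<le> real n ^ 3" by simp
    moreover have "active n w = 1" using False by (simp add: active_def)
    ultimately show ?thesis
      using mom_2_bounds[OF assms, of w] by (simp only: mult_1_right)
  qed
qed

lemma boundary_deviation:
  assumes "0 < n" "stable (run n w)"
  shows "\<bar>real_of_int (left_boundary (run n w)) + real n / 2 - mom 1 n w / real n\<bar> \<le> 3"
    "\<bar>real_of_int (right_boundary (run n w)) - real n / 2 - mom 1 n w / real n\<bar> \<le> 3"
proof -
  obtain l r where sp: "spread l r n (run n w)" using spread_run[OF assms(1)] by blast
  show "\<bar>real_of_int (left_boundary (run n w)) + real n / 2 - mom 1 n w / real n\<bar> \<le> 3"
    "\<bar>real_of_int (right_boundary (run n w)) - real n / 2 - mom 1 n w / real n\<bar> \<le> 3"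
    using stable_boundary_estimate(1,2)[OF sp assms(2,1)]
    by (simp_all add: spread_boundary[OF sp] mom_def)
qed

lemma topples_le_length: "topples n w \<le> real (length w)"
proof (induction w rule: rev_induct)
  case (snoc a w)
  then show ?case using active_bounds(2)[of n w] by (simp add: topples_def del: active_bounds)
qed (simp add: topples_def)

text \<open>Stability is absorbing, so an unstable end means that every earlier step was active
  too.\<close>

lemma topples_active: "active n w = 1 \<Longrightarrow> topples n w = real (length w)"
proof (induction w rule: rev_induct)
  case (snoc a w)
  then have "active n w = 1"
    by (auto simp: active_def run_snoc topple_def split: if_splits)
  then show ?case using snoc.IH by (simp add: topples_def)
qed (simp add: topples_def)

lemma active_le_topples: "active n w * real (length w) \<le> topples n w"
proof -
  have "0 \<le> topples n w" by (auto simp: topples_def acc_def intro: sum_nonneg)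
  then show ?thesis using active_cases[of n w] topples_active[of n w] by auto
qed

text \<open>Both indicators mark initial segments of time; the symmetric difference of two such
  segments has as many elements as their lengths differ.\<close>

lemma acc_window_gap:
  "acc (\<lambda>w _. \<bar>active n w - of_bool (length w < m)\<bar>) w = \<bar>topples n w - real (min m (length w))\<bar>"
proof (induction w rule: rev_induct)
  case (snoc a w)
  have t: "topples n (w @ [a]) = topples n w + active n w" by (simp add: topples_def)
  show ?case
  proof (cases "active n w = 1")
    case True
    then show ?thesis using snoc topples_active[OF True] by (auto simp: t min_def)
  next
    case False
    then have "active n w = 0" using active_cases by blast
    then show ?thesis using snoc topples_le_length[of n w] by (auto simp: t min_def)
  qed
qed (simp add: topples_def)

text \<open>The cutoff is deterministic and ignores stability, so this is a genuine sum of i.i.d.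
  steps.\<close>

definition walk :: "nat \<Rightarrow> instr list \<Rightarrow> real" where
  "walk m w = acc (\<lambda>w a. of_bool (length w < m) * displacement a) w"

locale sandpile = prob_space M for M :: "'a measure" +
  fixes \<xi> :: "int \<Rightarrow> nat \<Rightarrow> 'a \<Rightarrow> instr" and p :: real and n :: nat
  assumes p: "0 < p" "p < 1"
    and indep_instr: "indep_vars (\<lambda>_. count_space UNIV) (\<lambda>(x, i). \<xi> x i) UNIV"
    and law_instr: "prob {\<omega> \<in> space M. \<xi> x i \<omega> = a} = instr_prob p a"
begin

sublocale exploration M "\<lambda>(x, i). \<xi> x i" "instr_prob p" "next_index n"
  by unfold_locales (auto intro!: indep_instr law_instr dest: next_index_fresh)

text \<open>The odometers are compared only while the configuration is unstable, because the
  exploration goes on drawing at the origin afterwards.\<close>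

lemma sandpile_state_hist:
  "fst (sandpile_state (\<lambda>x i. \<xi> x i \<omega>) n k) = run n (hist k \<omega>) \<and>
   (\<not> stable (run n (hist k \<omega>)) \<longrightarrow>
     snd (sandpile_state (\<lambda>x i. \<xi> x i \<omega>) n k) = odometer n (hist k \<omega>))"
proof (induction k)
  case 0
  then show ?case by (auto simp: run_def odometer_def)
next
  case (Suc k)
  obtain \<eta> u where s: "sandpile_state (\<lambda>x i. \<xi> x i \<omega>) n k = (\<eta>, u)" by fastforce
  then have \<eta>: "\<eta> = run n (hist k \<omega>)" using Suc by simp
  show ?case
  proof (cases "stable \<eta>")
    case True
    then show ?thesis by (auto simp: s topple_step_def run_snoc topple_def \<eta>)
  next
    case False
    then have u: "u = odometer n (hist k \<omega>)" using Suc by (simp add: s \<eta>)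
    have x: "leftmost_unstable \<eta> = site \<eta>" using False by (simp add: site_def)
    have i: "(case next_index n (hist k \<omega>) of (x, i) \<Rightarrow> \<xi> x i) = \<xi> (site \<eta>) (u (site \<eta>))"
      by (simp add: next_index_def \<eta> u)
    show ?thesis using False
      by (auto simp: s topple_step_def Let_def run_snoc topple_def \<eta>[symmetric] x i odometer_def u delta_def)
  qed
qed

lemma sandpile_config_hist: "sandpile_config (\<lambda>x i. \<xi> x i \<omega>) n k = run n (hist k \<omega>)"
  using sandpile_state_hist by (simp add: sandpile_config_def)

lemma stable_hist_mono:
  "stable (run n (hist j \<omega>)) \<Longrightarrow> j \<le> k \<Longrightarrow> run n (hist k \<omega>) = run n (hist j \<omega>)"
proof (induction k)
  case (Suc k)
  then show ?case by (cases "j \<le> k") (auto simp: run_snoc topple_def le_Suc_eq)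
qed simp

text \<open>Any stable time will do, since the configuration is frozen from the first one
  on.\<close>

lemma final_config_hist:
  assumes "stable (run n (hist k \<omega>))"
  shows "final_config (\<lambda>x i. \<xi> x i \<omega>) n = run n (hist k \<omega>)"
proof -
  define S where "S = {k. stable (run n (hist k \<omega>))}"
  define T where "T = Inf S"
  have "k \<in> S" using assms by (simp add: S_def)
  then have "T \<in> S" "T \<le> k" unfolding T_def by (auto intro: Inf_nat_def1 cInf_lower)
  then have "run n (hist k \<omega>) = run n (hist T \<omega>)"
    by (intro stable_hist_mono) (auto simp: S_def)
  then show ?thesis
    by (simp add: final_config_def stab_time_def sandpile_config_hist S_def[symmetric] T_def)
qed

text \<open>The result depends on a natural number, the first stable time, and on the word read by
  then; with countably many choices no sigma-algebra on configurations is required.\<close>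

lemma final_config_measurable:
  fixes G :: "config \<Rightarrow> 'b"
  shows "(\<lambda>\<omega>. G (final_config (\<lambda>x i. \<xi> x i \<omega>) n)) \<in> measurable M (count_space UNIV)"
proof -
  have F: "(\<lambda>\<omega>. F (hist k \<omega>)) \<in> measurable M (count_space UNIV)" for F :: "instr list \<Rightarrow> 'b" and k
    by (rule measurable_compose[OF hist_measurable]) simp
  have "(\<lambda>\<omega>. stable (run n (hist k \<omega>))) \<in> measurable M (count_space UNIV)" for k
    by (rule measurable_compose[OF hist_measurable]) simp
  then have "(\<lambda>\<omega>. LEAST k. stable (run n (hist k \<omega>))) \<in> measurable M (count_space UNIV)"
    by (rule measurable_Least)
  from measurable_compose_countable[OF F this, of "\<lambda>k w. G (run n w)"]
  have "(\<lambda>\<omega>. G (run n (hist (LEAST k. stable (run n (hist k \<omega>))) \<omega>))) \<in> measurable M (count_space UNIV)" .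
  then show ?thesis
    by (simp add: final_config_def stab_time_def sandpile_config_hist Inf_nat_def)
qed

subsection \<open>Number of topplings\<close>

lemma sum_instr_prob:
  "(\<Sum>a\<in>UNIV. instr_prob p a * f a) =
    p * (1 - p) * f ToLeft + p * (1 - p) * f ToRight + p\<^sup>2 * f ToBoth + (1 - p)\<^sup>2 * f Nothing"
  for f :: "instr \<Rightarrow> real"
  by (simp add: UNIV_instr)

lemma sum_displacement: "(\<Sum>a\<in>UNIV. instr_prob p a * (c * displacement a)) = 0"
  unfolding sum_instr_prob by simp

lemma sum_displacement_square: "(\<Sum>a\<in>UNIV. instr_prob p a * (c * (displacement a)\<^sup>2)) = 2 * p * (1 - p) * c"
  unfolding sum_instr_prob by (simp add: algebra_simps power2_eq_square)

lemma sum_jumps: "(\<Sum>a\<in>UNIV. instr_prob p a * (c * (d * displacement a + jumps a))) = 2 * p * c"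
  unfolding sum_instr_prob by (simp add: algebra_simps power2_eq_square)

context
  assumes n: "0 < n"
begin

text \<open>This is Wald's identity for the second moment: each active step adds
  \<open>2 * p\<close> on average.\<close>

lemma expect_topples_eq: "expect k (mom 2 n) = 2 * p * expect k (topples n)"
proof -
  have "expect k (mom 2 n) = expect k (acc (\<lambda>w a. active n w * (2 * real_of_int (site (run n w)) * displacement a + jumps a)))"
    by (rule expect_cong) (rule mom_2_eq_acc[OF n])
  also have "\<dots> = expect k (\<lambda>w. acc (\<lambda>w _. 2 * p * active n w) w)"
    by (subst expect_acc) (simp only: sum_jumps)
  also have "\<dots> = 2 * p * expect k (topples n)"
    by (simp only: acc_cmult expect_cmult topples_def[abs_def])
  finally show ?thesis .
qed

lemma expect_topples_le: "expect k (topples n) \<le> real n ^ 3 / (2 * p)"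
proof -
  have "expect k (mom 2 n) \<le> expect k (\<lambda>_. real n ^ 3)"
    by (rule expect_mono) (rule mom_2_bounds[OF n])
  then show ?thesis using p by (simp add: expect_topples_eq expect_const field_simps)
qed

text \<open>Markov's inequality: being unstable at time \<open>k\<close> means at least
  \<open>k\<close> active steps.\<close>

lemma expect_active_le:
  assumes "0 < k"
  shows "expect k (active n) \<le> real n ^ 3 / (2 * p * real k)"
proof -
  have "real k * expect k (active n) \<le> expect k (topples n)"
    unfolding expect_cmult[symmetric]
    by (rule expect_mono) (use active_le_topples[of n] in \<open>auto simp: mult.commute\<close>)
  then have "expect k (active n) * real k \<le> real n ^ 3 / (2 * p)"
    using expect_topples_le[of k] by (simp add: mult.commute)
  then have "expect k (active n) \<le> real n ^ 3 / (2 * p) / real k"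
    using assms by (subst pos_le_divide_eq) simp_all
  then show ?thesis by simp
qed

lemma expect_mom_1_square_le: "expect k (\<lambda>w. (mom 1 n w)\<^sup>2) \<le> real n ^ 3"
proof -
  have "expect k (\<lambda>w. (mom 1 n w)\<^sup>2) = expect k (\<lambda>w. (acc (\<lambda>w a. active n w * displacement a) w)\<^sup>2)"
    by (rule expect_cong) (simp only: mom_1_eq_acc[OF n])
  also have "\<dots> = expect k (acc (\<lambda>w a. active n w * (displacement a)\<^sup>2))"
    by (subst expect_acc_square) (simp_all only: sum_displacement power_mult_distrib active_square)
  also have "\<dots> = expect k (\<lambda>w. acc (\<lambda>w _. 2 * p * (1 - p) * active n w) w)"
    by (subst expect_acc) (simp only: sum_displacement_square)
  also have "\<dots> = 2 * p * (1 - p) * expect k (topples n)"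
    by (simp only: acc_cmult expect_cmult topples_def[abs_def])
  also have "\<dots> \<le> 2 * p * (1 - p) * (real n ^ 3 / (2 * p))"
    using p by (intro mult_left_mono expect_topples_le) auto
  also have "\<dots> = (1 - p) * real n ^ 3" using p by simp
  also have "\<dots> \<le> 1 * real n ^ 3" using p by (intro mult_right_mono) auto
  finally show ?thesis by simp
qed

text \<open>The compensated second moment is a martingale with increments of at most
  \<open>6 * n\<close>, all zero after stabilization. Hence the bound is \<open>36 * n^2\<close>
  times the mean number of active steps, at most \<open>n^3 / (2 * p)\<close>.\<close>

lemma expect_mom_2_topples:
  "expect k (\<lambda>w. (mom 2 n w - 2 * p * topples n w)\<^sup>2) \<le> 18 * real n ^ 5 / p"
proof -
  define f where "f w a = active n w * (2 * real_of_int (site (run n w)) * displacement a + jumps a) - 2 * p * active n w"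
    for w a
  have eq: "mom 2 n w - 2 * p * topples n w = acc f w" for w
    unfolding f_def acc_diff acc_cmult mom_2_eq_acc[OF n] topples_def ..
  have c: "(\<Sum>a\<in>UNIV. instr_prob p a * f w a) = 0" for w
    unfolding f_def by (simp add: right_diff_distrib sum_subtractf sum_jumps sum_distrib_right[symmetric] sum_q)
  have b: "(f w a)\<^sup>2 \<le> 36 * (real n)\<^sup>2 * active n w" for w a
  proof -
    \<comment> \<open>The site term is at most \<open>2 * n\<close>, and \<open>jumps\<close> and
      \<open>2 * p\<close> are at most 2 each; \<open>n\<close> is at least 1.\<close>
    have "\<bar>2 * real_of_int (site (run n w)) * displacement a + jumps a - 2 * p\<bar> \<le> 6 * real n"
      using site_bound[OF n, of w] n p by (cases a) auto
    then have "(2 * real_of_int (site (run n w)) * displacement a + jumps a - 2 * p)\<^sup>2 \<le> (6 * real n)\<^sup>2"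
      using power_mono[OF _ abs_ge_zero, of _ "6 * real n" 2] by (metis power2_abs)
    then have "(2 * real_of_int (site (run n w)) * displacement a + jumps a - 2 * p)\<^sup>2 * active n w \<le> (6 * real n)\<^sup>2 * active n w"
      by (rule mult_right_mono) simp
    moreover have "f w a = active n w * (2 * real_of_int (site (run n w)) * displacement a + jumps a - 2 * p)"
      by (simp add: f_def algebra_simps)
    ultimately show ?thesis by (simp add: power_mult_distrib mult.commute)
  qed
  have "expect k (\<lambda>w. (mom 2 n w - 2 * p * topples n w)\<^sup>2) = expect k (acc (\<lambda>w a. (f w a)\<^sup>2))"
    unfolding eq by (rule expect_acc_square) (rule c)
  also have "\<dots> \<le> expect k (\<lambda>w. acc (\<lambda>w _. 36 * (real n)\<^sup>2 * active n w) w)"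
    by (intro expect_mono acc_mono b)
  also have "\<dots> = 36 * (real n)\<^sup>2 * expect k (topples n)"
    by (simp only: acc_cmult expect_cmult topples_def[abs_def])
  also have "\<dots> \<le> 36 * (real n)\<^sup>2 * (real n ^ 3 / (2 * p))"
    by (intro mult_left_mono expect_topples_le) auto
  also have "\<dots> = 18 * real n ^ 5 / p" using p by (simp add: field_simps power_add[symmetric])
  finally show ?thesis .
qed

text \<open>The horizon \<open>n ^ 4\<close> makes the probability of instability at most
  \<open>1 / (2 * p * n)\<close>, so that the crude error \<open>n ^ 3\<close> contributes only
  order \<open>n ^ 2\<close>.\<close>

lemma expect_mom_2_deviation:
  assumes "n ^ 4 \<le> k"
  shows "expect k (\<lambda>w. \<bar>mom 2 n w - real n ^ 3 / 12\<bar>) \<le> 6 * (real n)\<^sup>2 + (real n)\<^sup>2 / (2 * p)"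
proof -
  have k: "0 < k" using assms n by (metis gr0I le_zero_eq power_eq_0_iff less_irrefl)
  have kn: "real n ^ 4 \<le> real k" using assms by (metis of_nat_le_iff of_nat_power)
  have "expect k (\<lambda>w. \<bar>mom 2 n w - real n ^ 3 / 12\<bar>) \<le>
    expect k (\<lambda>w. 4 * (real n)\<^sup>2 + (2 / real n) * (mom 1 n w)\<^sup>2 + real n ^ 3 * active n w)"
    by (rule expect_mono) (rule mom_2_deviation[OF n])
  also have "\<dots> = 4 * (real n)\<^sup>2 + (2 / real n) * expect k (\<lambda>w. (mom 1 n w)\<^sup>2) + real n ^ 3 * expect k (active n)"
    by (simp only: expect_add expect_cmult expect_const)
  also have "\<dots> \<le> 4 * (real n)\<^sup>2 + (2 / real n) * real n ^ 3 + real n ^ 3 * (real n ^ 3 / (2 * p * real k))"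
    using n by (intro add_mono mult_left_mono expect_mom_1_square_le expect_active_le k) auto
  also have "\<dots> \<le> 4 * (real n)\<^sup>2 + (2 / real n) * real n ^ 3 + real n ^ 3 * (real n ^ 3 / (2 * p * real n ^ 4))"
    using n p kn by (intro add_mono mult_left_mono divide_left_mono mult_pos_pos) (use k in auto)
  also have "\<dots> = 6 * (real n)\<^sup>2 + (real n)\<^sup>2 / (2 * p)"
    using n p by (simp add: field_simps power2_eq_square power3_eq_cube power4_eq_xxxx)
  finally show ?thesis .
qed

lemma expect_topples_deviation:
  assumes "n ^ 4 \<le> k"
  shows "expect k (\<lambda>w. \<bar>topples n w - real n ^ 3 / (24 * p)\<bar>) \<le>
    (sqrt (18 * real n ^ 5 / p) + (6 * (real n)\<^sup>2 + (real n)\<^sup>2 / (2 * p))) / (2 * p)"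
proof -
  have "2 * p * expect k (\<lambda>w. \<bar>topples n w - real n ^ 3 / (24 * p)\<bar>)
    \<le> expect k (\<lambda>w. \<bar>mom 2 n w - 2 * p * topples n w\<bar> + \<bar>mom 2 n w - real n ^ 3 / 12\<bar>)"
    unfolding expect_cmult[symmetric]
  proof (rule expect_mono)
    fix w
    have "2 * p * \<bar>topples n w - real n ^ 3 / (24 * p)\<bar> = \<bar>2 * p * (topples n w - real n ^ 3 / (24 * p))\<bar>"
      using p by (simp add: abs_mult)
    also have "2 * p * (topples n w - real n ^ 3 / (24 * p)) = 2 * p * topples n w - real n ^ 3 / 12"
      using p by (simp add: field_simps)
    finally show "2 * p * \<bar>topples n w - real n ^ 3 / (24 * p)\<bar>
      \<le> \<bar>mom 2 n w - 2 * p * topples n w\<bar> + \<bar>mom 2 n w - real n ^ 3 / 12\<bar>" by simp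
  qed
  also have "\<dots> \<le> sqrt (18 * real n ^ 5 / p) + (6 * (real n)\<^sup>2 + (real n)\<^sup>2 / (2 * p))"
    unfolding expect_add
    by (intro add_mono expect_mom_2_deviation assms order_trans[OF expect_abs_le_sqrt]
        real_sqrt_le_mono expect_mom_2_topples)
  finally show ?thesis using p by (simp add: field_simps)
qed

text \<open>The difference collects the steps between time \<open>m\<close> and stabilization, in either order. It is a
  martingale, so no maximal inequality is needed to compare the walk at the two times.\<close>

lemma expect_mom_1_walk:
  assumes "m \<le> k"
  shows "expect k (\<lambda>w. (mom 1 n w - walk m w)\<^sup>2) = 2 * p * (1 - p) * expect k (\<lambda>w. \<bar>topples n w - real m\<bar>)"
proof -
  define g where "g w = active n w - of_bool (length w < m)" for w
  have g2: "(g w)\<^sup>2 = \<bar>g w\<bar>" for w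
    using active_cases[of n w] by (auto simp: g_def)
  have "mom 1 n w - walk m w = acc (\<lambda>w a. g w * displacement a) w" for w
    unfolding walk_def mom_1_eq_acc[OF n] acc_diff[symmetric] by (simp add: g_def left_diff_distrib)
  then have "expect k (\<lambda>w. (mom 1 n w - walk m w)\<^sup>2) = expect k (\<lambda>w. (acc (\<lambda>w a. g w * displacement a) w)\<^sup>2)"
    by simp
  also have "\<dots> = expect k (acc (\<lambda>w a. \<bar>g w\<bar> * (displacement a)\<^sup>2))"
    by (subst expect_acc_square) (simp_all only: sum_displacement power_mult_distrib g2)
  also have "\<dots> = expect k (\<lambda>w. acc (\<lambda>w _. 2 * p * (1 - p) * \<bar>g w\<bar>) w)"
    by (subst expect_acc) (simp only: sum_displacement_square)
  also have "\<dots> = 2 * p * (1 - p) * expect k (\<lambda>w. acc (\<lambda>w _. \<bar>g w\<bar>) w)"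
    by (simp only: acc_cmult expect_cmult)
  also have "expect k (\<lambda>w. acc (\<lambda>w _. \<bar>g w\<bar>) w) = expect k (\<lambda>w. \<bar>topples n w - real m\<bar>)"
    by (rule expect_cong) (use assms in \<open>simp add: g_def acc_window_gap min_absorb1\<close>)
  finally show ?thesis .
qed

end

end

subsection \<open>Characteristic functions\<close>

lemma norm_iexp_diff_le: "cmod (iexp a - iexp b) \<le> \<bar>a - b\<bar>"
proof -
  have "iexp a - iexp b = iexp b * (iexp (a - b) - 1)"
    by (simp add: right_diff_distrib exp_add[symmetric])
  then have "cmod (iexp a - iexp b) = 2 * \<bar>sin ((a - b) / 2)\<bar>"
    by (simp only: norm_mult norm_exp_i_times dist_exp_i_1 mult_1)
  also have "\<dots> \<le> 2 * \<bar>(a - b) / 2\<bar>"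
    by (intro mult_left_mono abs_sin_x_le_abs_x) simp
  finally show ?thesis by simp
qed

context sandpile
begin

text \<open>Each of the first \<open>m\<close> letters contributes the characteristic function of
  one lazy step; later letters contribute nothing, whence \<open>min m k\<close>.\<close>

lemma expect_iexp_walk:
  "expect k (\<lambda>w. iexp (t * walk m w)) = complex_of_real (1 - 2 * p * (1 - p) * (1 - cos t)) ^ min m k"
proof (induction k)
  case 0
  then show ?case by (simp add: expect_0 walk_def)
next
  case (Suc k)
  define \<phi> where "\<phi> = complex_of_real (1 - 2 * p * (1 - p) * (1 - cos t))"
  have one: "(\<Sum>a\<in>UNIV. instr_prob p a *\<^sub>R iexp (t * displacement a)) = \<phi>"
  proof -
    have "iexp t + iexp (- t) = complex_of_real (2 * cos t)"
      by (simp add: complex_eq_iff exp_eq_polar cis.code)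
    moreover have "(\<Sum>a\<in>UNIV. instr_prob p a *\<^sub>R iexp (t * displacement a)) =
        complex_of_real (p * (1 - p)) * (iexp t + iexp (- t)) + complex_of_real (p\<^sup>2 + (1 - p)\<^sup>2)"
      by (simp add: UNIV_instr scaleR_conv_of_real algebra_simps)
    moreover have "p * (1 - p) * (2 * cos t) + (p\<^sup>2 + (1 - p)\<^sup>2) = 1 - 2 * p * (1 - p) * (1 - cos t)"
      by (simp add: power2_eq_square algebra_simps)
    ultimately show ?thesis by (simp only: \<phi>_def of_real_mult[symmetric] of_real_add[symmetric])
  qed
  have step: "(\<Sum>a\<in>UNIV. instr_prob p a *\<^sub>R iexp (t * walk m (w @ [a])))
    = iexp (t * walk m w) * (if k < m then \<phi> else 1)" if "length w = k" for w
  proof (cases "k < m")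
    case True
    have "iexp (t * walk m (w @ [a])) = iexp (t * walk m w) * iexp (t * displacement a)" for a
      using True that by (simp add: walk_def exp_add[symmetric] distrib_left)
    then show ?thesis using True
      by (simp add: one[symmetric] sum_distrib_left)
  next
    case False
    then have "walk m (w @ [a]) = walk m w" for a using that by (simp add: walk_def)
    then show ?thesis using False sum_q by (simp add: scaleR_sum_left[symmetric])
  qed
  have "expect (Suc k) (\<lambda>w. iexp (t * walk m w)) = expect k (\<lambda>w. iexp (t * walk m w) * (if k < m then \<phi> else 1))"
    unfolding expect_Suc by (rule expect_cong) (rule step)
  also have "\<dots> = expect k (\<lambda>w. iexp (t * walk m w)) * (if k < m then \<phi> else 1)"
    by (simp add: expect_def)
  also have "\<dots> = \<phi> ^ min m (Suc k)"
    unfolding Suc \<phi>_def[symmetric] by (auto simp: min_def le_Suc_eq)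
  finally show ?case by (simp add: \<phi>_def)
qed

text \<open>If stable at time \<open>k\<close>, the boundary is compared with \<open>mom 1\<close>
  and that with the walk, using that \<open>iexp\<close> is 1-Lipschitz. Otherwise two unit vectors
  differ by at most 2.\<close>

lemma char_boundary_le:
  fixes B :: "'a \<Rightarrow> real"
  assumes n: "0 < n" and "m \<le> k" and [measurable]: "B \<in> borel_measurable M"
    and B: "\<And>\<omega>. stable (run n (hist k \<omega>)) \<Longrightarrow> \<bar>B \<omega> - mom 1 n (hist k \<omega>) / real n\<bar> \<le> 3"
  shows "cmod (char (distr M borel (\<lambda>\<omega>. B \<omega> / sqrt n)) t
      - complex_of_real (1 - 2 * p * (1 - p) * (1 - cos (t / (n * sqrt n)))) ^ m)
    \<le> \<bar>t\<bar> * (3 / sqrt n) + \<bar>t\<bar> / (n * sqrt n) * expect k (\<lambda>w. \<bar>mom 1 n w - walk m w\<bar>) + 2 * expect k (active n)"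
proof -
  define s where "s = t / (n * sqrt n)"
  have sq: "0 < sqrt n" using n by simp
  have int1: "integrable M (\<lambda>\<omega>. iexp (t * (B \<omega> / sqrt n)))"
    by (rule integrable_const_bound[where B = 1]) (auto simp del: of_real_mult of_real_divide)
  have int2: "integrable M (\<lambda>\<omega>. iexp (s * walk m (hist k \<omega>)))"
    by (rule integrable_hist)
  have bound: "cmod (iexp (t * (B \<omega> / sqrt n)) - iexp (s * walk m (hist k \<omega>)))
    \<le> \<bar>t\<bar> * (3 / sqrt n) + \<bar>t\<bar> / (n * sqrt n) * \<bar>mom 1 n (hist k \<omega>) - walk m (hist k \<omega>)\<bar> + 2 * active n (hist k \<omega>)"
    for \<omega>
  proof (cases "stable (run n (hist k \<omega>))")
    case True
    have "t * (B \<omega> / sqrt n) - s * walk m (hist k \<omega>) =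
      t / sqrt n * (B \<omega> - mom 1 n (hist k \<omega>) / n) + s * (mom 1 n (hist k \<omega>) - walk m (hist k \<omega>))"
      using n by (simp add: s_def field_simps)
    also have "\<bar>\<dots>\<bar> \<le> \<bar>t / sqrt n * (B \<omega> - mom 1 n (hist k \<omega>) / n)\<bar> + \<bar>s * (mom 1 n (hist k \<omega>) - walk m (hist k \<omega>))\<bar>"
      by (rule abs_triangle_ineq)
    also have "\<dots> = \<bar>t\<bar> / sqrt n * \<bar>B \<omega> - mom 1 n (hist k \<omega>) / n\<bar> + \<bar>t\<bar> / (n * sqrt n) * \<bar>mom 1 n (hist k \<omega>) - walk m (hist k \<omega>)\<bar>"
      using sq by (simp add: s_def abs_mult abs_divide)
    also have "\<dots> \<le> \<bar>t\<bar> / sqrt n * 3 + \<bar>t\<bar> / (n * sqrt n) * \<bar>mom 1 n (hist k \<omega>) - walk m (hist k \<omega>)\<bar>"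
      using sq by (intro add_right_mono mult_left_mono B True) auto
    finally have "\<bar>t * (B \<omega> / sqrt n) - s * walk m (hist k \<omega>)\<bar>
      \<le> \<bar>t\<bar> * (3 / sqrt n) + \<bar>t\<bar> / (n * sqrt n) * \<bar>mom 1 n (hist k \<omega>) - walk m (hist k \<omega>)\<bar>" by simp
    then show ?thesis
      using norm_iexp_diff_le[of "t * (B \<omega> / sqrt n)" "s * walk m (hist k \<omega>)"] active_bounds(1)[of n "hist k \<omega>"]
      by linarith
  next
    case False
    have "cmod (iexp (t * (B \<omega> / sqrt n)) - iexp (s * walk m (hist k \<omega>))) \<le> 1 + 1"
      by (rule order_trans[OF norm_triangle_ineq4]) (simp only: norm_exp_i_times order.refl)
    moreover have "active n (hist k \<omega>) = 1" using False by (simp add: active_def)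
    moreover have "0 \<le> \<bar>t\<bar> * (3 / sqrt n)" "0 \<le> \<bar>t\<bar> / (n * sqrt n) * \<bar>mom 1 n (hist k \<omega>) - walk m (hist k \<omega>)\<bar>"
      by simp_all
    ultimately show ?thesis by linarith
  qed
  have "char (distr M borel (\<lambda>\<omega>. B \<omega> / sqrt n)) t = (LINT \<omega>|M. iexp (t * (B \<omega> / sqrt n)))"
    unfolding char_def by (subst integral_distr) auto
  moreover have "complex_of_real (1 - 2 * p * (1 - p) * (1 - cos s)) ^ m = (LINT \<omega>|M. iexp (s * walk m (hist k \<omega>)))"
    using expect_iexp_walk[of k s m] assms(2) by (simp only: expect_def min_absorb1)
  ultimately have "char (distr M borel (\<lambda>\<omega>. B \<omega> / sqrt n)) t - complex_of_real (1 - 2 * p * (1 - p) * (1 - cos s)) ^ m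
    = (LINT \<omega>|M. iexp (t * (B \<omega> / sqrt n)) - iexp (s * walk m (hist k \<omega>)))"
    using int1 int2 by (simp only: Bochner_Integration.integral_diff)
  also have "cmod \<dots> \<le> (LINT \<omega>|M. cmod (iexp (t * (B \<omega> / sqrt n)) - iexp (s * walk m (hist k \<omega>))))"
    by (rule integral_norm_bound)
  also have "\<dots> \<le> (LINT \<omega>|M. \<bar>t\<bar> * (3 / sqrt n) + \<bar>t\<bar> / (n * sqrt n) * \<bar>mom 1 n (hist k \<omega>) - walk m (hist k \<omega>)\<bar> + 2 * active n (hist k \<omega>))"
    by (intro integral_mono bound integrable_norm Bochner_Integration.integrable_diff int1 int2 integrable_hist)
  also have "\<dots> = expect k (\<lambda>w. \<bar>t\<bar> * (3 / sqrt n) + \<bar>t\<bar> / (n * sqrt n) * \<bar>mom 1 n w - walk m w\<bar> + 2 * active n w)"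
    by (simp only: expect_def)
  also have "\<dots> = \<bar>t\<bar> * (3 / sqrt n) + \<bar>t\<bar> / (n * sqrt n) * expect k (\<lambda>w. \<bar>mom 1 n w - walk m w\<bar>) + 2 * expect k (active n)"
    by (simp only: expect_add expect_cmult expect_const)
  finally show ?thesis by (simp only: s_def)
qed

end

section \<open>Limits of the error, of the walk and of the boundaries\<close>

definition char_error :: "real \<Rightarrow> real \<Rightarrow> real \<Rightarrow> real" where
  "char_error p t x = \<bar>t\<bar> * (3 / sqrt x) + \<bar>t\<bar> / (x * sqrt x) *
     sqrt (2 * p * (1 - p) * ((sqrt (18 * x ^ 5 / p) + (6 * x\<^sup>2 + x\<^sup>2 / (2 * p))) / (2 * p) + 1)) + 1 / (p * x)"

text \<open>The summands are of order \<open>x powr (-1/2)\<close>, \<open>x powr (-1/4)\<close> and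
  \<open>1 / x\<close>; the middle one comes from the fluctuation of the number of steps.\<close>

lemma char_error_tendsto:
  assumes "0 < p" "p < 1"
  shows "(\<lambda>n. char_error p t (real n)) \<longlonglongrightarrow> 0"
proof -
  have "0 < 1 - p" using assms by simp
  then show ?thesis unfolding char_error_def using assms by real_asymp
qed

definition walk_time :: "real \<Rightarrow> nat \<Rightarrow> nat" where
  "walk_time p n = nat \<lfloor>real n ^ 3 / (24 * p)\<rfloor>"

text \<open>The logarithm of one factor is about \<open>- p * (1 - p) * t^2 / n^3\<close>;
  multiplied by the number of steps, about \<open>n^3 / (24 * p)\<close>, it gives
  \<open>- (1 - p) * t^2 / 24\<close>.\<close>

lemma walk_char_tendsto:
  assumes p: "0 < p" "p < 1"
  shows "(\<lambda>n. (1 - 2 * p * (1 - p) * (1 - cos (t / (real n * sqrt (real n))))) ^ walk_time p n)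
    \<longlonglongrightarrow> exp (- ((1 - p) / 12) * t\<^sup>2 / 2)"
proof -
  define c where "c = 2 * p * (1 - p)"
  have c: "0 < c" using p by (simp add: c_def)
  have "(\<lambda>n. real (walk_time p n) / real n ^ 3) \<longlonglongrightarrow> inverse p / 24"
    unfolding walk_time_def using p by real_asymp
  then have time: "(\<lambda>n. real (walk_time p n) / real n ^ 3) \<longlonglongrightarrow> 1 / (24 * p)"
    using p by (simp add: field_simps)
  have "(\<lambda>n. real n ^ 3 * ln (1 - c * (1 - cos (t / (real n * sqrt (real n)))))) \<longlonglongrightarrow> - (c * (t * t) / 2)"
    using c by real_asymp
  then have ln: "(\<lambda>n. real n ^ 3 * ln (1 - c * (1 - cos (t / (real n * sqrt (real n)))))) \<longlonglongrightarrow> - c * t\<^sup>2 / 2"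
    by (simp add: power2_eq_square)
  have pos: "\<forall>\<^sub>F n in sequentially. 0 < 1 - c * (1 - cos (t / (real n * sqrt (real n))))"
    using c by real_asymp
  have "(\<lambda>n. exp (real (walk_time p n) / real n ^ 3 * (real n ^ 3 * ln (1 - c * (1 - cos (t / (real n * sqrt (real n))))))))
    \<longlonglongrightarrow> exp (1 / (24 * p) * (- c * t\<^sup>2 / 2))"
    by (intro tendsto_intros time ln)
  then have "(\<lambda>n. (1 - c * (1 - cos (t / (real n * sqrt (real n))))) ^ walk_time p n)
    \<longlonglongrightarrow> exp (1 / (24 * p) * (- c * t\<^sup>2 / 2))"
  proof (rule Lim_transform_eventually)
    show "\<forall>\<^sub>F n in sequentially.
    exp (real (walk_time p n) / real n ^ 3 * (real n ^ 3 * ln (1 - c * (1 - cos (t / (real n * sqrt (real n)))))))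
    = (1 - c * (1 - cos (t / (real n * sqrt (real n))))) ^ walk_time p n"
      using pos eventually_gt_at_top[of 0] by eventually_elim (simp add: exp_of_nat_mult)
  qed
  moreover have "1 / (24 * p) * (- c * t\<^sup>2 / 2) = - ((1 - p) / 12) * t\<^sup>2 / 2"
    using p by (simp add: c_def field_simps)
  ultimately show ?thesis by (simp only: c_def)
qed

lemma centered_normal_eq_distr:
  assumes "0 < v"
  shows "centered_normal v = distr std_normal_distribution borel (\<lambda>x. sqrt v * x)"
proof -
  interpret real_distribution std_normal_distribution by (rule real_dist_normal_dist)
  have "distributed std_normal_distribution lborel (\<lambda>x. x) (\<lambda>x. ennreal (normal_density 0 1 x))"
    unfolding distributed_def by (auto intro!: distr_id2)
  from normal_density_affine[OF this, of "sqrt v" 0] assms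
  have "distributed std_normal_distribution lborel (\<lambda>x. sqrt v * x) (\<lambda>x. ennreal (normal_density 0 (sqrt v) x))"
    by simp
  then have "distr std_normal_distribution lborel (\<lambda>x. sqrt v * x) = centered_normal v"
    unfolding centered_normal_def by (rule distributed_distr_eq_density)
  then show ?thesis by (metis distr_cong sets_lborel)
qed

lemma real_distribution_centered_normal: "0 < v \<Longrightarrow> real_distribution (centered_normal v)"
proof -
  interpret real_distribution std_normal_distribution by (rule real_dist_normal_dist)
  show "0 < v \<Longrightarrow> ?thesis" unfolding centered_normal_eq_distr by (rule real_distribution_distr) simp
qed

lemma char_centered_normal:
  assumes "0 < v"
  shows "char (centered_normal v) t = complex_of_real (exp (- v * t\<^sup>2 / 2))"
proof -
  have "char (centered_normal v) t = char std_normal_distribution (t * sqrt v)"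
    unfolding centered_normal_eq_distr[OF assms] char_def
    by (subst integral_distr) (auto simp: mult.assoc)
  also have "\<dots> = complex_of_real (exp (- v * t\<^sup>2 / 2))"
    using assms by (simp add: char_std_normal_distribution power_mult_distrib mult.commute)
  finally show ?thesis .
qed

lemma (in sandpile) char_boundary_error:
  fixes B :: "'a \<Rightarrow> real"
  assumes n: "0 < n" and "B \<in> borel_measurable M"
    and B: "\<And>k \<omega>. stable (run n (hist k \<omega>)) \<Longrightarrow> \<bar>B \<omega> - mom 1 n (hist k \<omega>) / real n\<bar> \<le> 3"
  shows "cmod (char (distr M borel (\<lambda>\<omega>. B \<omega> / sqrt n)) t
      - complex_of_real (1 - 2 * p * (1 - p) * (1 - cos (t / (n * sqrt n)))) ^ walk_time p n)
    \<le> char_error p t n"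
proof -
  define m where "m = walk_time p n"
  \<comment> \<open>a time far beyond the typical order \<open>n\<^sup>3\<close> of the stabilization time\<close>
  define k where "k = n ^ 4 + m"
  define D where "D = (sqrt (18 * real n ^ 5 / p) + (6 * (real n)\<^sup>2 + (real n)\<^sup>2 / (2 * p))) / (2 * p)"
  have mk: "m \<le> k" "n ^ 4 \<le> k" "0 < k" using n by (auto simp: k_def)
  \<comment> \<open>Nonnegativity keeps \<open>nat\<close> from truncating, so rounding costs at
    most 1; this is the \<open>+ 1\<close> inside \<open>char_error\<close>.\<close>
  have "0 \<le> real n ^ 3 / (24 * p)" using p by simp
  then have m: "\<bar>real n ^ 3 / (24 * p) - real m\<bar> \<le> 1"
    unfolding m_def walk_time_def by linarith
  have "expect k (\<lambda>w. \<bar>topples n w - real m\<bar>) \<le> expect k (\<lambda>w. \<bar>topples n w - real n ^ 3 / (24 * p)\<bar> + 1)"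
    by (rule expect_mono) (use m in linarith)
  also have "\<dots> \<le> D + 1"
    unfolding expect_add expect_const D_def by (intro add_right_mono expect_topples_deviation n mk)
  finally have dev: "expect k (\<lambda>w. \<bar>topples n w - real m\<bar>) \<le> D + 1" .
  have "expect k (\<lambda>w. \<bar>mom 1 n w - walk m w\<bar>) \<le> sqrt (expect k (\<lambda>w. (mom 1 n w - walk m w)\<^sup>2))"
    by (rule expect_abs_le_sqrt)
  also have "\<dots> \<le> sqrt (2 * p * (1 - p) * (D + 1))"
    unfolding expect_mom_1_walk[OF n mk(1)] using p dev by (intro real_sqrt_le_mono mult_left_mono) auto
  finally have walk: "expect k (\<lambda>w. \<bar>mom 1 n w - walk m w\<bar>) \<le> sqrt (2 * p * (1 - p) * (D + 1))" .
  have "real n ^ 4 \<le> real k" using mk(2) by (metis of_nat_le_iff of_nat_power)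
  then have "real n ^ 3 / (2 * p * real k) \<le> real n ^ 3 / (2 * p * real n ^ 4)"
    using p n mk(3) by (intro divide_left_mono mult_left_mono mult_pos_pos) auto
  also have "\<dots> = 1 / (p * n) / 2"
    using n p by (simp add: field_simps power3_eq_cube power4_eq_xxxx)
  finally have "expect k (active n) \<le> 1 / (p * n) / 2"
    by (rule order_trans[OF expect_active_le[OF n mk(3)]])
  from mult_left_mono[OF this, of 2] have act: "2 * expect k (active n) \<le> 1 / (p * n)" by simp
  have "cmod (char (distr M borel (\<lambda>\<omega>. B \<omega> / sqrt n)) t
      - complex_of_real (1 - 2 * p * (1 - p) * (1 - cos (t / (n * sqrt n)))) ^ m)
    \<le> \<bar>t\<bar> * (3 / sqrt n) + \<bar>t\<bar> / (n * sqrt n) * expect k (\<lambda>w. \<bar>mom 1 n w - walk m w\<bar>) + 2 * expect k (active n)"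
    by (rule char_boundary_le) (use assms mk in auto)
  also have "\<dots> \<le> \<bar>t\<bar> * (3 / sqrt n) + \<bar>t\<bar> / (n * sqrt n) * sqrt (2 * p * (1 - p) * (D + 1)) + 1 / (p * n)"
    by (intro add_mono mult_left_mono walk act) auto
  finally show ?thesis by (simp only: m_def D_def char_error_def)
qed

text \<open>Both boundaries, after centring by \<open>n / 2\<close>, stay within 3 of the same
  quantity, so one statement about \<open>B\<close> serves them both.\<close>

lemma weak_conv_boundary:
  fixes B :: "nat \<Rightarrow> 'a \<Rightarrow> real" and \<xi> :: "int \<Rightarrow> nat \<Rightarrow> 'a \<Rightarrow> instr"
  assumes sp: "sandpile M \<xi> p"
    and meas: "\<And>n. B n \<in> borel_measurable M"
    and B: "\<And>n k \<omega>. 0 < n \<Longrightarrow> stable (run n (exploration.hist (\<lambda>(x, i). \<xi> x i) (next_index n) k \<omega>)) \<Longrightarrow>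
      \<bar>B n \<omega> - mom 1 n (exploration.hist (\<lambda>(x, i). \<xi> x i) (next_index n) k \<omega>) / real n\<bar> \<le> 3"
  shows "weak_conv_m (\<lambda>n. distr M borel (\<lambda>\<omega>. B n \<omega> / sqrt (real n))) (centered_normal ((1 - p) / 12))"
proof (rule levy_continuity)
  \<comment> \<open>The same instructions drive the stabilization for every \<open>n\<close>, so the
    locale is available for all \<open>n\<close> at once.\<close>
  interpret sandpile M \<xi> p n for n by (rule sp)
  have v: "0 < (1 - p) / 12" using p by simp
  show "real_distribution (distr M borel (\<lambda>\<omega>. B n \<omega> / sqrt (real n)))" for n
    by (rule real_distribution_distr) (use meas in measurable)
  show "real_distribution (centered_normal ((1 - p) / 12))"
    by (rule real_distribution_centered_normal[OF v])
  fix t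
  define \<phi> where "\<phi> n = complex_of_real (1 - 2 * p * (1 - p) * (1 - cos (t / (real n * sqrt (real n))))) ^ walk_time p n" for n
  have "\<phi> \<longlonglongrightarrow> char (centered_normal ((1 - p) / 12)) t"
    unfolding char_centered_normal[OF v] \<phi>_def of_real_power[symmetric]
    by (intro tendsto_of_real walk_char_tendsto p)
  moreover have "(\<lambda>n. char (distr M borel (\<lambda>\<omega>. B n \<omega> / sqrt (real n))) t - \<phi> n) \<longlonglongrightarrow> 0"
  proof (rule Lim_null_comparison[OF _ char_error_tendsto[OF p, of t]])
    show "\<forall>\<^sub>F n in sequentially. cmod (char (distr M borel (\<lambda>\<omega>. B n \<omega> / sqrt (real n))) t - \<phi> n) \<le> char_error p t (real n)"
      using eventually_gt_at_top[of 0]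
      by eventually_elim (unfold \<phi>_def, intro char_boundary_error meas B)
  qed
  ultimately show "(\<lambda>n. char (distr M borel (\<lambda>\<omega>. B n \<omega> / sqrt (real n))) t) \<longlonglongrightarrow> char (centered_normal ((1 - p) / 12)) t"
    by (rule Lim_transform)
qed

theorem theorem1p2:
  fixes M :: "'a measure" and \<xi> :: "int \<Rightarrow> nat \<Rightarrow> 'a \<Rightarrow> instr" and p :: real
  assumes "prob_space M"
    and "0 < p" and "p < 1"
    and "prob_space.indep_vars M (\<lambda>_. count_space UNIV) (\<lambda>(x, i). \<xi> x i) UNIV"
    and "\<And>x i a. measure M {\<omega> \<in> space M. \<xi> x i \<omega> = a} = instr_prob p a"
  shows "weak_conv_m
           (\<lambda>n. distr M borel (\<lambda>\<omega>.
              (real_of_int (left_boundary (final_config (\<lambda>x i. \<xi> x i \<omega>) n)) + real n / 2) / sqrt (real n)))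
           (centered_normal ((1 - p) / 12))
       \<and> weak_conv_m
           (\<lambda>n. distr M borel (\<lambda>\<omega>.
              (real_of_int (right_boundary (final_config (\<lambda>x i. \<xi> x i \<omega>) n)) - real n / 2) / sqrt (real n)))
           (centered_normal ((1 - p) / 12))"
proof -
  have sp: "sandpile M \<xi> p"
    using assms by (simp add: sandpile_def sandpile_axioms_def)
  interpret sandpile M \<xi> p n for n by (rule sp)
  have meas: "(\<lambda>\<omega>. real_of_int (G (final_config (\<lambda>x i. \<xi> x i \<omega>) n)) + c) \<in> borel_measurable M" for G c n
    by (rule measurable_compose[OF final_config_measurable[of _ n]]) simp
  show ?thesis
  proof (intro conjI weak_conv_boundary[OF sp])
    show "(\<lambda>\<omega>. real_of_int (left_boundary (final_config (\<lambda>x i. \<xi> x i \<omega>) n)) + real n / 2) \<in> borel_measurable M" for n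
      by (rule meas)
    show "(\<lambda>\<omega>. real_of_int (right_boundary (final_config (\<lambda>x i. \<xi> x i \<omega>) n)) - real n / 2) \<in> borel_measurable M" for n
      using meas[of right_boundary n "- (real n / 2)"] by simp
  next
    fix n k \<omega>
    assume n: "0 < n" and st: "stable (run n (hist n k \<omega>))"
    show "\<bar>real_of_int (left_boundary (final_config (\<lambda>x i. \<xi> x i \<omega>) n)) + real n / 2 - mom 1 n (hist n k \<omega>) / real n\<bar> \<le> 3"
      "\<bar>real_of_int (right_boundary (final_config (\<lambda>x i. \<xi> x i \<omega>) n)) - real n / 2 - mom 1 n (hist n k \<omega>) / real n\<bar> \<le> 3"
      unfolding final_config_hist[OF st] by (rule boundary_deviation[OF n st])+
  qed
qed

end
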